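(* For all positive constants $\alpha$, $a$ and $K_0$ there exist constants $$c_1^\circ = c_1^\circ(\alpha)>0,\qquad c_2^\circ=c_2^\circ(\alpha,a)>0,\qquad d_\star=d_\star(\alpha)>0,\qquad C_{K_0}>0$$ (each depending only on the indicated parameters, and $C_{K_0}$ only on $K_0$) with the following property. Given $n\geq 2$, set $d=pn$, and suppose that $d\geq d_\star$. Let $G=(V,E)$ be an $n$-vertex $(p,\beta)$-bijumbled graph satisfying $$\delta(G)\geq \alpha d \qquad\text{and}\qquad \beta\leq a d.$$ Let $\mathcal A$ be an $h$-edge configuration family on $V$, where $2\leq h\leq Q$. For a $(Q,\mathcal K)$-uniform colouring of $G$, let $S\subseteq\mathcal K$ have size $\ell\geq h$, and set $$\rho=\frac{\ell-h+1}{Q}\qquad\text{and}\qquad \widehat\beta = 5\rho\beta + C_{K_0}\left(\sqrt{\rho c_2^\circ d}+\sqrt{\log n}\right).$$ Suppose further that a number $b_\star\geq 0$ satisfies $\widehat\beta\leq b_\star$, and that every $n$-vertex $(\rho p,b_\star)$-bijumbled graph $J$ with vertex-set $V$ satisfying $$\delta(J)\geq \frac{c_1^\circ}{2}\rho d$$ supports $\mathcal A$. Then $$\Pr\left[G\text{ contains an $S$-rainbow member of }\mathcal A\right]\geq 1-(2n)^{-K_0}-n\cdot\exp\left(-\frac{c_1^\circ\rho d}{8}\right).$$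
   Context: Graphs are finite and simple; $\delta(G)$ is the minimum degree. For a graph $G$ and $X,Y\subseteq V(G)$ let $\vec e_G(X,Y) = |\{(x,y)\in X\times Y : xy\in E(G)\}|$. For $0<p\leq 1$ and $\beta\geq 0$, an $n$-vertex graph $G$ is $(p,\beta)$-bijumbled if $\left|\vec e_G(X,Y) - p|X||Y|\right| \leq \beta\sqrt{|X||Y|}$ for all $X,Y\subseteq V(G)$. For a fixed $n$-element set $V$, an $h$-edge configuration family on $V$ is a family $\mathcal A\subseteq\binom{\binom V2}{h}$, i.e. a set whose members are sets of exactly $h$ unordered pairs of elements of $V$. A graph $J$ on $V$ supports $\mathcal A$ if $E(J)$ contains some member of $\mathcal A$. Let $\mathcal K$ be a palette of $Q$ colours. A $(Q,\mathcal K)$-uniform colouring of $G$ assigns every edge of $G$ a colour chosen independently and uniformly at random from $\mathcal K$. For $S\subseteq\mathcal K$, $G$ contains an $S$-rainbow member of $\mathcal A$ if some $A\in\mathcal A$ satisfies $A\subseteq E(G)$ and the colours of the edges of $A$ are pairwise distinct and all belong to $S$. The set $S$ is fixed (it does not depend on the random colouring). *)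

theory Defs
  imports "HOL-Probability.Probability" "HOL-Library.Ramsey"
begin

text \<open>
  A finite simple graph is given by its vertex set \<open>V\<close> and its set \<open>E\<close> of edges, the edges being
  two-element subsets of \<open>V\<close>.
\<close>

definition simple_graph :: "'v set \<Rightarrow> 'v set set \<Rightarrow> bool" where
  "simple_graph V E \<longleftrightarrow> finite V \<and> E \<subseteq> nsets V 2"

definition degree :: "'v set set \<Rightarrow> 'v \<Rightarrow> nat" where
  "degree E v = card {e \<in> E. v \<in> e}"

text \<open>Only meaningful for finite nonempty \<open>V\<close>.\<close>

definition min_degree :: "'v set \<Rightarrow> 'v set set \<Rightarrow> nat" where
  "min_degree V E = Min (degree E ` V)"

text \<open>Ordered pairs are counted, so an edge inside \<open>X \<inter> Y\<close> contributes twice.\<close>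

definition e_pairs :: "'v set set \<Rightarrow> 'v set \<Rightarrow> 'v set \<Rightarrow> nat" where
  "e_pairs E X Y = card {(x, y) \<in> X \<times> Y. {x, y} \<in> E}"

definition bijumbled :: "real \<Rightarrow> real \<Rightarrow> 'v set \<Rightarrow> 'v set set \<Rightarrow> bool" where
  "bijumbled p \<beta> V E \<longleftrightarrow>
     (\<forall>X Y. X \<subseteq> V \<and> Y \<subseteq> V \<longrightarrow>
        \<bar>real (e_pairs E X Y) - p * real (card X) * real (card Y)\<bar>
          \<le> \<beta> * sqrt (real (card X) * real (card Y)))"

definition configuration_family :: "nat \<Rightarrow> 'v set \<Rightarrow> 'v set set set \<Rightarrow> bool" where
  "configuration_family h V \<A> \<longleftrightarrow> \<A> \<subseteq> nsets (nsets V 2) h"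

definition supports :: "'v set set \<Rightarrow> 'v set set set \<Rightarrow> bool" where
  "supports E \<A> \<longleftrightarrow> (\<exists>A\<in>\<A>. A \<subseteq> E)"

text \<open>
  Colourings are total functions; off the edge set \<open>E\<close> they take the dummy value \<open>undefined\<close>.
\<close>

definition uniform_colouring :: "'c set \<Rightarrow> 'v set set \<Rightarrow> ('v set \<Rightarrow> 'c) pmf" where
  "uniform_colouring K E = Pi_pmf E undefined (\<lambda>_. pmf_of_set K)"

definition contains_rainbow ::
    "'v set set \<Rightarrow> ('v set \<Rightarrow> 'c) \<Rightarrow> 'c set \<Rightarrow> 'v set set set \<Rightarrow> bool" where
  "contains_rainbow E \<phi> S \<A> \<longleftrightarrow>
     (\<exists>A\<in>\<A>. A \<subseteq> E \<and> inj_on \<phi> A \<and> \<phi> ` A \<subseteq> S)"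

end

theory Submission
  imports Defs
begin

text \<open>
The theorem holds for three reasons, one about colours and two about random subgraphs.

\<^bold>\<open>Colours.\<close> Compare the random colouring with the random graph in which every edge \<open>e\<close> survives
independently with some probability \<open>r e \<le> \<rho>\<close>, where \<open>\<rho> = (l - h + 1) / Q\<close>. Pass from survival to
colours one edge at a time. If the current edge decides the outcome, then it completes a member of \<open>\<A>\<close>
whose other edges carry at most \<open>h - 1\<close> colours. A random colour is a new colour of \<open>S\<close> with probability at
least \<open>\<rho>\<close>, so the exchange cannot lower the probability of success. Hence an \<open>S\<close>-rainbow member is at least
as likely as a member inside the random subgraph (\<open>prob_supports_le_prob_rainbow\<close>), and it remains to choose
\<open>r\<close> so that the random subgraph satisfies the hypothesis on the graphs \<open>J\<close>.

\<^bold>\<open>Bounded degrees.\<close> Bijumbledness with \<open>\<beta>\<close> of order \<open>d\<close> leaves room for vertices of degree far above \<open>d\<close>,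
and a random subgraph fluctuates too much around these. So \<open>r = \<rho> q\<close> for edge weights \<open>q\<close> in \<open>[0, 1]\<close> that give
each vertex a weighted degree between \<open>\<alpha> d / 2\<close> and a constant multiple of \<open>d\<close>. Only edges at vertices
of degree above \<open>3 d\<close> lose weight. There are so few such vertices that the weights \<open>q\<close> are still bijumbled
from below with \<open>4 \<beta>\<close>, and from above with \<open>\<beta>\<close> (\<open>bounded_degree_weighting\<close>). The weights come from a
flow in which every vertex sends \<open>\<alpha> d / 2\<close> units along its edges and which spreads the loads evenly, by
minimising the sum of their squares. Bijumbledness bounds the largest load.

\<^bold>\<open>Concentration.\<close> Let \<open>D\<close> bound the weighted degrees of \<open>r\<close>, let \<open>n = card V\<close> and
\<open>\<sigma>\<^sup>2 = D + ln (2 n)\<close>. Write \<open>s\<close> for \<open>sqrt (card X * card Y)\<close>. With the required probability the number of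
edges between any \<open>X\<close> and \<open>Y\<close> differs from \<open>\<rho> p (card X) (card Y)\<close> by at most
\<open>(5 \<rho> \<beta> + O(\<sigma>)) s\<close> (\<open>random_subgraph_bijumbled\<close>). If the main term exceeds this error, Bernstein's
inequality survives a union bound over all \<open>4^n\<close> pairs (\<open>dense_pairs_tail\<close>). Otherwise only the upper bound
has content, but a union bound over the pairs fails: they are too many. Instead, put aside the vertices
with few neighbours on the other side and, recursively, a small remainder. The other vertices of \<open>X\<close> and \<open>Y\<close> are
adjacent to a seed set \<open>W\<close> of size \<open>O(s / \<sigma>)\<close>. The edges that avoid \<open>W\<close> are independent of the
neighbourhood \<open>N\<close> of \<open>W\<close>, so once \<open>W\<close> is chosen and its edges are revealed, only \<open>4^(card N)\<close> pairs remain,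
and \<open>card N = O(\<sigma> s)\<close> by the bound on the degrees. That many pairs are affordable
(\<open>seed_excess_tail_all\<close>), and \<open>discrepancy_upper_bound\<close> draws the conclusion for arbitrary pairs.

The minimum degree follows from a Chernoff bound at every vertex.
\<close>

section \<open>Rainbow members and random subgraphs\<close>

text \<open>
The coordinate \<open>x\<close> may be drawn first or last. Drawn last, it can be exchanged for another distribution while all
other coordinates are fixed; drawn first, it leaves a product over \<open>E\<close> to which induction applies.
\<close>

lemma emeasure_Pi_pmf_insert:
  assumes "finite E" "x \<notin> E"
  shows "emeasure (measure_pmf (Pi_pmf (insert x E) d p)) \<Omega> =
           (\<integral>\<^sup>+z. emeasure (measure_pmf (Pi_pmf E d p)) {f. f(x := z) \<in> \<Omega>} \<partial>measure_pmf (p x))"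
    and "emeasure (measure_pmf (Pi_pmf (insert x E) d p)) \<Omega> =
           (\<integral>\<^sup>+f. emeasure (measure_pmf (p x)) {z. f(x := z) \<in> \<Omega>} \<partial>measure_pmf (Pi_pmf E d p))"
proof -
  have 1: "Pi_pmf (insert x E) d p = p x \<bind> (\<lambda>z. map_pmf (\<lambda>f. f(x := z)) (Pi_pmf E d p))"
    using assms by (simp add: Pi_pmf_insert' map_pmf_def)
  have 2: "Pi_pmf (insert x E) d p = Pi_pmf E d p \<bind> (\<lambda>f. map_pmf (\<lambda>z. f(x := z)) (p x))"
    using assms by (simp add: Pi_pmf_insert' map_pmf_def bind_commute_pmf[of "p x"])
  show "emeasure (measure_pmf (Pi_pmf (insert x E) d p)) \<Omega> =
           (\<integral>\<^sup>+z. emeasure (measure_pmf (Pi_pmf E d p)) {f. f(x := z) \<in> \<Omega>} \<partial>measure_pmf (p x))"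
    by (subst 1) (simp add: vimage_def)
  show "emeasure (measure_pmf (Pi_pmf (insert x E) d p)) \<Omega> =
           (\<integral>\<^sup>+f. emeasure (measure_pmf (p x)) {z. f(x := z) \<in> \<Omega>} \<partial>measure_pmf (Pi_pmf E d p))"
    by (subst 2) (simp add: vimage_def)
qed

lemma Pi_pmf_emeasure_mono_componentwise:
  assumes "finite E"
    and "\<And>e f. e \<in> E \<Longrightarrow> emeasure (measure_pmf (p e)) {z. f(e := z) \<in> \<Omega>}
                          \<le> emeasure (measure_pmf (p' e)) {z. f(e := z) \<in> \<Omega>}"
  shows "emeasure (measure_pmf (Pi_pmf E d p)) \<Omega> \<le> emeasure (measure_pmf (Pi_pmf E d p')) \<Omega>"
  using assms
proof (induction E arbitrary: \<Omega> rule: finite_induct)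
  case empty
  then show ?case by simp
next
  case (insert x E)
  have "emeasure (measure_pmf (Pi_pmf (insert x E) d p)) \<Omega>
      = (\<integral>\<^sup>+f. emeasure (measure_pmf (p x)) {z. f(x := z) \<in> \<Omega>} \<partial>measure_pmf (Pi_pmf E d p))"
    by (rule emeasure_Pi_pmf_insert(2)[OF insert.hyps(1,2)])
  also have "\<dots> \<le> (\<integral>\<^sup>+f. emeasure (measure_pmf (p' x)) {z. f(x := z) \<in> \<Omega>} \<partial>measure_pmf (Pi_pmf E d p))"
    by (intro nn_integral_mono insert.prems) simp
  also have "\<dots> = (\<integral>\<^sup>+z. emeasure (measure_pmf (Pi_pmf E d p)) {f. f(x := z) \<in> \<Omega>} \<partial>measure_pmf (p' x))"
  proof -
    have "Pi_pmf E d (p(x := p' x)) = Pi_pmf E d p"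
      by (rule Pi_pmf_cong) (use insert.hyps(2) in auto)
    then show ?thesis
      using emeasure_Pi_pmf_insert[OF insert.hyps(1,2), of d "p(x := p' x)" \<Omega>] by simp
  qed
  also have "\<dots> \<le> (\<integral>\<^sup>+z. emeasure (measure_pmf (Pi_pmf E d p')) {f. f(x := z) \<in> \<Omega>} \<partial>measure_pmf (p' x))"
  proof (intro nn_integral_mono insert.IH)
    fix z e f
    assume e: "e \<in> E"
    then have "e \<noteq> x" using insert.hyps(2) by auto
    then show "emeasure (measure_pmf (p e)) {y. f(e := y) \<in> {f. f(x := z) \<in> \<Omega>}}
             \<le> emeasure (measure_pmf (p' e)) {y. f(e := y) \<in> {f. f(x := z) \<in> \<Omega>}}"
      unfolding mem_Collect_eq fun_upd_twist[OF \<open>e \<noteq> x\<close>]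
      by (intro insert.prems) (use e in simp)
  qed
  also have "\<dots> = emeasure (measure_pmf (Pi_pmf (insert x E) d p')) \<Omega>"
    by (rule emeasure_Pi_pmf_insert(1)[OF insert.hyps(1,2), symmetric])
  finally show ?case .
qed

text \<open>
In a hybrid outcome an edge is either coloured (\<open>Inl\<close>) or has survived or not (\<open>Inr\<close>). If all edges are of the
first kind, this says that \<open>A\<close> is \<open>S\<close>-rainbow, and if all are of the second kind, that \<open>A\<close> survives.
\<close>

definition good_hybrid :: "'v set set \<Rightarrow> 'c set \<Rightarrow> ('v set \<Rightarrow> 'c + bool) \<Rightarrow> bool" where
  "good_hybrid A S w \<longleftrightarrow>
     (\<forall>e\<in>A. case w e of Inl c \<Rightarrow> c \<in> S | Inr b \<Rightarrow> b) \<and>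
     (\<forall>e\<in>A. \<forall>e'\<in>A. e \<noteq> e' \<longrightarrow> w e \<in> range Inl \<longrightarrow> w e \<noteq> w e')"

text \<open>
The edges of \<open>A\<close> other than \<open>e\<close> use at most \<open>h - 1\<close> colours, so at least \<open>l - (h - 1)\<close> colours of \<open>S\<close> are left
for \<open>e\<close>.
\<close>

lemma good_hybrid_colour:
  assumes A: "finite A" "card A = h" "e \<in> A"
    and K: "finite K" "card K = Q" "S \<subseteq> K" "card S = l" "h \<le> l"
    and good: "good_hybrid A S (w(e := Inr True))"
  shows "(real l - real h + 1) / real Q
           \<le> measure_pmf.prob (pmf_of_set K) {c. good_hybrid A S (w(e := Inl c))}"
proof -
  define U where "U = {c. \<exists>e'\<in>A - {e}. w e' = Inl c}"
  have U_sub: "U \<subseteq> (\<lambda>e'. projl (w e')) ` (A - {e})" unfolding U_def by force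
  then have finU: "finite U" using A(1) finite_surj by blast
  have "card U \<le> card (A - {e})"
    using A(1) U_sub by (meson card_image_le card_mono finite_Diff finite_imageI le_trans)
  also have "\<dots> = h - 1" using A by simp
  finally have cU: "card U \<le> h - 1" .
  have h: "h \<ge> 1" using A by (metis card_gt_0_iff emptyE less_eq_Suc_le One_nat_def)
  have finS: "finite S" using K finite_subset by blast
  have Kne: "K \<noteq> {}" using K h by (metis card.empty card_mono finite.emptyI le_zero_eq not_one_le_zero subset_empty)
  have cS: "real l - real h + 1 \<le> real (card (S - U))"
  proof -
    have "card S - card U \<le> card (S - U)" using finU by (rule diff_card_le_card_Diff)
    then show ?thesis using cU h K(4,5) by linarith
  qed
  have sub: "S - U \<subseteq> K \<inter> {c. good_hybrid A S (w(e := Inl c))}"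
  proof
    fix c assume c: "c \<in> S - U"
    have "good_hybrid A S (w(e := Inl c))"
      unfolding good_hybrid_def
    proof (intro conjI ballI impI)
      fix e1 assume "e1 \<in> A"
      then show "case (w(e := Inl c)) e1 of Inl c \<Rightarrow> c \<in> S | Inr b \<Rightarrow> b"
        using c good unfolding good_hybrid_def by (auto split: if_splits)
    next
      fix e1 e2 assume *: "e1 \<in> A" "e2 \<in> A" "e1 \<noteq> e2" "(w(e := Inl c)) e1 \<in> range Inl"
      have g: "\<forall>e1\<in>A. \<forall>e2\<in>A. e1 \<noteq> e2 \<longrightarrow> (w(e := Inr True)) e1 \<in> range Inl
          \<longrightarrow> (w(e := Inr True)) e1 \<noteq> (w(e := Inr True)) e2"
        using good unfolding good_hybrid_def by blast
      consider "e1 = e" | "e2 = e" | "e1 \<noteq> e" "e2 \<noteq> e" by blast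
      then show "(w(e := Inl c)) e1 \<noteq> (w(e := Inl c)) e2"
      proof cases
        case 1
        then show ?thesis using * c unfolding U_def by auto
      next
        case 2
        then show ?thesis using * c unfolding U_def by auto
      next
        case 3
        then show ?thesis using g[rule_format, of e1 e2] * by auto
      qed
    qed
    then show "c \<in> K \<inter> {c. good_hybrid A S (w(e := Inl c))}" using c K by auto
  qed
  have "real (card (S - U)) \<le> real (card (K \<inter> {c. good_hybrid A S (w(e := Inl c))}))"
    using card_mono[OF _ sub] K(1) by simp
  then show ?thesis
    using cS K Kne by (simp add: measure_pmf_of_set divide_right_mono)
qed

text \<open>
Change the law of one edge after another from survival to a random colour. Given all other edges, an
exchange matters only if some member of \<open>\<A>\<close> needs just this edge, and then colouring it helps with
probability at least \<open>(l - h + 1) / Q\<close>, which is at least the survival probability.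
\<close>

lemma prob_supports_le_prob_rainbow:
  fixes r :: "'v set \<Rightarrow> real" and K S :: "'c set"
  assumes E: "finite E"
    and r: "\<And>e. e \<in> E \<Longrightarrow> 0 \<le> r e" "\<And>e. e \<in> E \<Longrightarrow> r e \<le> 1"
    and r_le: "\<And>e. e \<in> E \<Longrightarrow> r e \<le> (real l - real h + 1) / real Q"
    and \<A>: "\<And>A. A \<in> \<A> \<Longrightarrow> finite A \<and> card A = h"
    and K: "finite K" "card K = Q" "S \<subseteq> K" "card S = l" "h \<le> l"
  shows "measure_pmf.prob (Pi_pmf E False (\<lambda>e. bernoulli_pmf (r e))) {w. supports {e \<in> E. w e} \<A>}
       \<le> measure_pmf.prob (uniform_colouring K E) {\<phi>. contains_rainbow E \<phi> S \<A>}"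
proof -
  define \<Omega> :: "('v set \<Rightarrow> 'c + bool) set" where "\<Omega> = {w. \<exists>A\<in>\<A>. A \<subseteq> E \<and> good_hybrid A S w}"
  define P where "P = (\<lambda>e. map_pmf (Inr :: bool \<Rightarrow> 'c + bool) (bernoulli_pmf (r e)))"
  define P' where "P' = (\<lambda>e :: 'v set. map_pmf (Inl :: 'c \<Rightarrow> 'c + bool) (pmf_of_set K))"
  have swap: "emeasure (measure_pmf (P e)) {z. w(e := z) \<in> \<Omega>}
      \<le> emeasure (measure_pmf (P' e)) {z. w(e := z) \<in> \<Omega>}" if e: "e \<in> E" for e w
  proof (cases "w(e := Inr False) \<in> \<Omega>")
    case True
    then obtain A where A: "A \<in> \<A>" "A \<subseteq> E" "good_hybrid A S (w(e := Inr False))"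
      unfolding \<Omega>_def by blast
    have "e \<notin> A" using A(3) unfolding good_hybrid_def by (metis (mono_tags, lifting) fun_upd_same sum.simps(6))
    then have "good_hybrid A S (w(e := z))" for z
      using A(3) unfolding good_hybrid_def by (smt (verit) fun_upd_other)
    then have "{z. w(e := z) \<in> \<Omega>} = UNIV" using A unfolding \<Omega>_def by auto
    then show ?thesis by (simp add: measure_pmf.emeasure_eq_1_AE)
  next
    case F: False
    show ?thesis
    proof (cases "w(e := Inr True) \<in> \<Omega>")
      case True
      then obtain A where A: "A \<in> \<A>" "A \<subseteq> E" "good_hybrid A S (w(e := Inr True))"
        unfolding \<Omega>_def by blast
      have "e \<in> A"
      proof (rule ccontr)
        assume "e \<notin> A"
        then have "good_hybrid A S (w(e := Inr False))"
          using A(3) unfolding good_hybrid_def by (smt (verit) fun_upd_other)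
        then show False using F A unfolding \<Omega>_def by auto
      qed
      have eq: "Inr -` {z. w(e := z) \<in> \<Omega>} = {True}"
        using F True by (auto) (metis (full_types))
      have "measure_pmf.prob (P e) {z. w(e := z) \<in> \<Omega>} = r e"
        using r[OF e] unfolding P_def measure_map_pmf eq by (simp add: measure_pmf_single)
      also have "\<dots> \<le> (real l - real h + 1) / real Q" using r_le[OF e] .
      also have "\<dots> \<le> measure_pmf.prob (pmf_of_set K) {c. good_hybrid A S (w(e := Inl c))}"
        using good_hybrid_colour[OF _ _ \<open>e \<in> A\<close> K A(3)] \<A>[OF A(1)] by blast
      also have "\<dots> \<le> measure_pmf.prob (P' e) {z. w(e := z) \<in> \<Omega>}"
        unfolding P'_def using A by (auto simp: \<Omega>_def intro!: measure_pmf.finite_measure_mono)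
      finally show ?thesis
        by (simp add: measure_pmf.emeasure_eq_measure)
    next
      case False
      then have "Inr -` {z. w(e := z) \<in> \<Omega>} = {}"
        using F by (auto) (metis (full_types))
      then show ?thesis unfolding P_def by simp
    qed
  qed
  have le: "measure_pmf.prob (Pi_pmf E (Inr False) P) \<Omega> \<le> measure_pmf.prob (Pi_pmf E (Inr False) P') \<Omega>"
    using Pi_pmf_emeasure_mono_componentwise[OF E swap, of "Inr False"]
    by (simp add: measure_pmf.emeasure_eq_measure)
  have L: "measure_pmf.prob (Pi_pmf E (Inr False) P) \<Omega>
      = measure_pmf.prob (Pi_pmf E False (\<lambda>e. bernoulli_pmf (r e))) {w. supports {e \<in> E. w e} \<A>}"
  proof -
    have "Pi_pmf E (Inr False) P = map_pmf (\<lambda>h. Inr \<circ> h) (Pi_pmf E False (\<lambda>e. bernoulli_pmf (r e)))"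
      unfolding P_def by (rule Pi_pmf_map) (use E in auto)
    moreover have "(\<lambda>h. Inr \<circ> h) -` \<Omega> = {w. supports {e \<in> E. w e} \<A>}"
      unfolding \<Omega>_def supports_def good_hybrid_def by (auto simp: subset_iff) 
    ultimately show ?thesis by simp
  qed
  have R: "measure_pmf.prob (Pi_pmf E (Inr False) P') \<Omega>
      = measure_pmf.prob (uniform_colouring K E) {\<phi>. contains_rainbow E \<phi> S \<A>}"
  proof -
    have dflt: "Pi_pmf E (Inl undefined) P' = map_pmf (\<lambda>h. Inl \<circ> h) (uniform_colouring K E)"
      unfolding P'_def uniform_colouring_def by (rule Pi_pmf_map) (use E in auto)
    \<comment> \<open>The two products differ only in their values off \<open>E\<close>, and \<open>\<Omega>\<close> does not depend on these.\<close>
    have sw: "Pi_pmf E (Inr False) P' = map_pmf (\<lambda>f x. if x \<in> E then f x else Inr False) (Pi_pmf E (Inl undefined) P')"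
      using Pi_pmf_default_swap[OF E, of "Inr False" "Inl undefined" P'] by simp
    have gh: "good_hybrid A S (\<lambda>x. if x \<in> E then (Inl \<circ> \<phi>) x else Inr False) \<longleftrightarrow> inj_on \<phi> A \<and> \<phi> ` A \<subseteq> S"
      if "A \<subseteq> E" for A and \<phi> :: "'v set \<Rightarrow> 'c"
      unfolding good_hybrid_def inj_on_def image_subset_iff using that by (simp add: subset_iff) blast
    have "(\<lambda>h. Inl \<circ> h) -` (\<lambda>f x. if x \<in> E then f x else Inr False) -` \<Omega> = {\<phi>. contains_rainbow E \<phi> S \<A>}"
      unfolding \<Omega>_def contains_rainbow_def vimage_Collect_eq using gh by blast
    then show ?thesis unfolding sw dflt measure_map_pmf by (rule arg_cong)
  qed
  show ?thesis using le L R by simp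
qed

section \<open>Weights of pairs of vertex sets\<close>

text \<open>
As in \<^const>\<open>e_pairs\<close>, pairs are ordered. For the indicator of an edge set this is \<^const>\<open>e_pairs\<close>, for edge
probabilities it is the expected value of \<^const>\<open>e_pairs\<close>.
\<close>

definition weight :: "('v set \<Rightarrow> real) \<Rightarrow> 'v set \<Rightarrow> 'v set \<Rightarrow> real" where
  "weight g X Y = (\<Sum>x\<in>X. \<Sum>y\<in>Y. g {x, y})"

lemma weight_commute: "weight g X Y = weight g Y X"
  unfolding weight_def by (subst sum.swap) (simp add: insert_commute)

lemma weight_empty [simp]: "weight g {} Y = 0" "weight g X {} = 0"
  by (simp_all add: weight_def)

lemma weight_nonneg: "(\<And>e. 0 \<le> g e) \<Longrightarrow> 0 \<le> weight g X Y"
  unfolding weight_def by (intro sum_nonneg)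

lemma weight_mono: "(\<And>e. g e \<le> g' e) \<Longrightarrow> weight g X Y \<le> weight g' X Y"
  unfolding weight_def by (intro sum_mono)

lemma weight_mult_left: "weight (\<lambda>e. c * g e) X Y = c * weight g X Y"
  unfolding weight_def by (simp add: sum_distrib_left)

lemma weight_diff: "weight (\<lambda>e. g e - g' e) X Y = weight g X Y - weight g' X Y"
  unfolding weight_def by (simp add: sum_subtractf)

lemma weight_Un_right:
  assumes "finite Y" "finite Y'" "Y \<inter> Y' = {}"
  shows "weight g X (Y \<union> Y') = weight g X Y + weight g X Y'"
  unfolding weight_def using assms by (simp add: sum.union_disjoint sum.distrib)

lemma e_pairs_eq_weight:
  assumes "finite X" "finite Y"
  shows "real (e_pairs J X Y) = weight (\<lambda>e. of_bool (e \<in> J)) X Y"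
proof -
  have "{(x, y) \<in> X \<times> Y. {x, y} \<in> J} = (SIGMA x:X. {y \<in> Y. {x, y} \<in> J})" by auto
  then have "e_pairs J X Y = (\<Sum>x\<in>X. card {y \<in> Y. {x, y} \<in> J})"
    unfolding e_pairs_def using assms by simp
  then show ?thesis
    unfolding weight_def using assms by (simp add: of_bool_def sum.If_cases Int_def)
qed

lemma weight_eq_sum_edges:
  assumes "finite X" "finite Y" "finite E" "\<And>e. e \<notin> E \<Longrightarrow> g e = 0"
  shows "weight g X Y = (\<Sum>e\<in>E. weight (\<lambda>e'. of_bool (e' = e)) X Y * g e)"
proof -
  have g: "g f = (\<Sum>e\<in>E. of_bool (f = e) * g e)" for f
  proof -
    have "(\<Sum>e\<in>E. of_bool (f = e) * g e) = (\<Sum>e\<in>E. if f = e then g e else 0)"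
      by (intro sum.cong) auto
    then show ?thesis using assms by simp
  qed
  have "weight g X Y = (\<Sum>x\<in>X. \<Sum>y\<in>Y. \<Sum>e\<in>E. of_bool ({x,y} = e) * g e)"
    unfolding weight_def by (intro sum.cong refl g)
  also have "\<dots> = (\<Sum>x\<in>X. \<Sum>e\<in>E. \<Sum>y\<in>Y. of_bool ({x,y} = e) * g e)"
    by (intro sum.cong refl sum.swap)
  also have "\<dots> = (\<Sum>e\<in>E. \<Sum>x\<in>X. \<Sum>y\<in>Y. of_bool ({x,y} = e) * g e)"
    by (rule sum.swap)
  also have "\<dots> = (\<Sum>e\<in>E. weight (\<lambda>e'. of_bool (e' = e)) X Y * g e)"
    unfolding weight_def by (simp add: sum_distrib_right)
  finally show ?thesis .
qed

text \<open>
An edge with both ends in \<open>X \<inter> Y\<close> is counted once in each direction.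
\<close>

lemma weight_single_edge_le_2:
  assumes "finite X" "finite Y" "e \<in> nsets V 2"
  shows "weight (\<lambda>e'. of_bool (e' = e)) X Y \<le> 2"
proof -
  obtain a b where e: "e = {a, b}" using assms(3) by (meson nsets2_E)
  have sub: "{(x, y). (x, y) \<in> X \<times> Y \<and> {x, y} \<in> {e}} \<subseteq> {(a, b), (b, a)}"
  proof (rule subsetI)
    fix z assume "z \<in> {(x, y). (x, y) \<in> X \<times> Y \<and> {x, y} \<in> {e}}"
    then obtain x y where "z = (x, y)" "{x, y} = {a, b}" using e by blast
    then show "z \<in> {(a, b), (b, a)}" by (metis doubleton_eq_iff insertCI)
  qed
  have "e_pairs {e} X Y \<le> card {(a, b), (b, a)}"
    unfolding e_pairs_def by (rule card_mono[OF _ sub]) simp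
  also have "\<dots> \<le> 2" using card_insert_le_m1[of 2 "{(b, a)}" "(a, b)"] by simp
  finally have "real (e_pairs {e} X Y) \<le> 2" by simp
  then show ?thesis using e_pairs_eq_weight[OF assms(1,2), of "{e}"] by simp
qed

lemma weight_of_bool_le:
  assumes "finite X" "finite Y" "\<And>y. y \<in> Y \<Longrightarrow> real (card {x \<in> X. {x, y} \<in> J}) \<le> c"
  shows "weight (\<lambda>e. of_bool (e \<in> J)) X Y \<le> c * real (card Y)"
proof -
  have "weight (\<lambda>e. of_bool (e \<in> J)) X Y = (\<Sum>y\<in>Y. \<Sum>x\<in>X. of_bool ({x, y} \<in> J))"
    unfolding weight_def by (rule sum.swap)
  also have "\<dots> = (\<Sum>y\<in>Y. real (card {x \<in> X. {x, y} \<in> J}))"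
    using assms(1) by (simp add: of_bool_def sum.If_cases Int_def)
  also have "\<dots> \<le> (\<Sum>y\<in>Y. c)" by (intro sum_mono assms)
  finally show ?thesis by (simp add: mult.commute)
qed

text \<open>
A bound that fails only on edges meeting \<open>W\<close> costs no more than the edges with an end in \<open>X \<inter> W\<close> or \<open>Y \<inter> W\<close>.
This serves twice: for the edges at a seed set, and for the edges at the vertices of huge degree.
\<close>

lemma weight_le_meeting:
  assumes fin: "finite X" "finite Y"
    and g: "\<And>e. e \<inter> W = {} \<Longrightarrow> g e \<le> g' e" "\<And>e. g e \<le> g' e + j e" "\<And>e. 0 \<le> j e"
  shows "weight g X Y \<le> weight g' X Y + (weight j X (Y \<inter> W) + weight j (X \<inter> W) Y)"
proof -
  have 1: "weight j X (Y \<inter> W) = (\<Sum>x\<in>X. \<Sum>y\<in>Y. if y \<in> W then j {x, y} else 0)"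
    unfolding weight_def by (intro sum.cong refl sum.inter_restrict fin)
  have 2: "weight j (X \<inter> W) Y = (\<Sum>x\<in>X. \<Sum>y\<in>Y. if x \<in> W then j {x, y} else 0)"
    unfolding weight_def sum.inter_restrict[OF fin(1)] by (intro sum.cong refl) auto
  have "weight g X Y \<le> (\<Sum>x\<in>X. \<Sum>y\<in>Y. g' {x, y} + ((if y \<in> W then j {x, y} else 0) + (if x \<in> W then j {x, y} else 0)))"
    unfolding weight_def
  proof (intro sum_mono)
    fix x y
    show "g {x, y} \<le> g' {x, y} + ((if y \<in> W then j {x, y} else 0) + (if x \<in> W then j {x, y} else 0))"
      using g(1)[of "{x, y}"] g(2,3)[of "{x, y}"] by auto
  qed
  then show ?thesis unfolding 1 2 by (simp add: weight_def sum.distrib)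
qed

lemma bijumbled_weight:
  assumes "bijumbled p \<beta> V E" "finite V" "X \<subseteq> V" "Y \<subseteq> V"
  shows "\<bar>weight (\<lambda>e. of_bool (e \<in> E)) X Y - p * real (card X) * real (card Y)\<bar>
           \<le> \<beta> * sqrt (real (card X) * real (card Y))"
proof -
  have "real (e_pairs E X Y) = weight (\<lambda>e. of_bool (e \<in> E)) X Y"
    by (rule e_pairs_eq_weight) (use assms in \<open>auto intro: finite_subset[of _ V]\<close>)
  moreover have "\<bar>real (e_pairs E X Y) - p * real (card X) * real (card Y)\<bar>
      \<le> \<beta> * sqrt (real (card X) * real (card Y))"
    using assms(1,3,4) unfolding bijumbled_def by blast
  ultimately show ?thesis by simp
qed

lemma bijumbled_mono: "bijumbled p \<beta> V E \<Longrightarrow> \<beta> \<le> \<beta>' \<Longrightarrow> bijumbled p \<beta>' V E"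
  unfolding bijumbled_def by (meson mult_right_mono of_nat_0_le_iff mult_nonneg_nonneg order_trans real_sqrt_ge_zero)

lemma bij_betw_incident_edges:
  assumes "E \<subseteq> nsets V 2" "v \<in> V"
  shows "bij_betw (\<lambda>u. {u, v}) {u \<in> V. {u, v} \<in> E} {e \<in> E. v \<in> e}"
proof (rule bij_betw_imageI)
  show "inj_on (\<lambda>u. {u, v}) {u \<in> V. {u, v} \<in> E}" by (rule inj_onI) (metis doubleton_eq_iff)
  show "(\<lambda>u. {u, v}) ` {u \<in> V. {u, v} \<in> E} = {e \<in> E. v \<in> e}"
  proof (intro set_eqI iffI)
    fix e assume e: "e \<in> {e \<in> E. v \<in> e}"
    then have "e \<in> nsets V 2" using assms(1) by blast
    then obtain a b where "e = {a, b}" "a \<in> V" "b \<in> V" by (rule nsets2_E)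
    then show "e \<in> (\<lambda>u. {u, v}) ` {u \<in> V. {u, v} \<in> E}" using e by (auto simp: insert_commute)
  qed auto
qed

lemma card_neighbours_eq:
  assumes "J \<subseteq> nsets V 2" "v \<in> V"
  shows "card {u \<in> V. {u, v} \<in> J} = card {e \<in> J. v \<in> e}"
  using bij_betw_incident_edges[OF assms] by (rule bij_betw_same_card)

section \<open>Tail bounds for independent edges\<close>

lemma prob_ex_le_sum:
  assumes "finite I" "\<And>i. i \<in> I \<Longrightarrow> measure_pmf.prob M {w. P i w} \<le> f i"
  shows "measure_pmf.prob M {w. \<exists>i\<in>I. P i w} \<le> sum f I"
proof -
  have "{w. \<exists>i\<in>I. P i w} = (\<Union>i\<in>I. {w. P i w})" by auto
  then have "measure_pmf.prob M {w. \<exists>i\<in>I. P i w} \<le> (\<Sum>i\<in>I. measure_pmf.prob M {w. P i w})"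
    using measure_pmf.finite_measure_subadditive_finite[OF assms(1), of "\<lambda>i. {w. P i w}" M] by simp
  also have "\<dots> \<le> sum f I" using assms(2) by (rule sum_mono)
  finally show ?thesis .
qed

lemma prob_pair_pmf_le:
  assumes "\<And>f. measure_pmf.prob q {g. P f g} \<le> \<epsilon>"
  shows "measure_pmf.prob (pair_pmf p q) {z. P (fst z) (snd z)} \<le> \<epsilon>"
proof -
  have \<epsilon>: "0 \<le> \<epsilon>" using assms[of undefined] measure_nonneg order_trans by blast
  have "emeasure (measure_pmf (pair_pmf p q)) {z. P (fst z) (snd z)}
      = (\<integral>\<^sup>+f. emeasure (measure_pmf q) {g. P f g} \<partial>measure_pmf p)"
    by (simp add: pair_pmf_def map_pmf_def[symmetric] vimage_def)
  also have "\<dots> \<le> (\<integral>\<^sup>+f. ennreal \<epsilon> \<partial>measure_pmf p)"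
    using assms by (intro nn_integral_mono) (simp add: measure_pmf.emeasure_eq_measure ennreal_leI)
  also have "\<dots> = ennreal \<epsilon>" by simp
  finally show ?thesis using \<epsilon> by (simp add: measure_pmf.emeasure_eq_measure)
qed

definition random_edges :: "'v set set \<Rightarrow> ('v set \<Rightarrow> real) \<Rightarrow> ('v set \<Rightarrow> bool) pmf" where
  "random_edges E r = Pi_pmf E False (\<lambda>e. bernoulli_pmf (r e))"

lemma finite_set_pmf_random_edges:
  assumes "finite E"
  shows "finite (set_pmf (random_edges E r))"
  unfolding random_edges_def set_Pi_pmf[OF assms] using assms by (intro finite_PiE_dflt) auto

text \<open>
Markov's inequality for the exponential moment. Each independent factor is \<open>1 + r e (exp (s e) - 1)\<close>, hence at most
\<open>exp (r e (exp (s e) - 1))\<close>. The parameter \<open>s\<close> varies with the edge, so that the same bound covers degrees and weights.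
\<close>

lemma random_edges_exp_tail:
  assumes E: "finite E" and r: "\<And>e. e \<in> E \<Longrightarrow> 0 \<le> r e \<and> r e \<le> 1"
  shows "measure_pmf.prob (random_edges E r) {w. c < (\<Sum>e\<in>E. s e * of_bool (w e))}
           \<le> exp ((\<Sum>e\<in>E. r e * (exp (s e) - 1)) - c)"
proof -
  let ?M = "random_edges E r"
  let ?u = "\<lambda>w. \<Prod>e\<in>E. exp (s e * of_bool (w e))"
  have u: "?u w = exp (\<Sum>e\<in>E. s e * of_bool (w e))" for w by (simp only: exp_sum[OF E])
  have "measure_pmf.expectation ?M ?u
      = (\<Prod>e\<in>E. measure_pmf.expectation (bernoulli_pmf (r e)) (\<lambda>v. exp (s e * of_bool v)))"
    unfolding random_edges_def
    by (rule expectation_prod_Pi_pmf) (auto intro!: E integrable_measure_pmf_finite)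
  also have "\<dots> \<le> (\<Prod>e\<in>E. exp (r e * (exp (s e) - 1)))"
  proof (intro prod_mono conjI)
    fix e assume e: "e \<in> E"
    show "0 \<le> measure_pmf.expectation (bernoulli_pmf (r e)) (\<lambda>v. exp (s e * of_bool v))"
      by (intro integral_nonneg_AE) auto
    have "measure_pmf.expectation (bernoulli_pmf (r e)) (\<lambda>v. exp (s e * of_bool v))
        = 1 + r e * (exp (s e) - 1)"
      using r[OF e] by (simp add: algebra_simps)
    also have "\<dots> \<le> exp (r e * (exp (s e) - 1))" by (rule exp_ge_add_one_self)
    finally show "measure_pmf.expectation (bernoulli_pmf (r e)) (\<lambda>v. exp (s e * of_bool v))
        \<le> exp (r e * (exp (s e) - 1))" .
  qed
  also have "\<dots> = exp (\<Sum>e\<in>E. r e * (exp (s e) - 1))" using E by (simp add: exp_sum)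
  finally have exp_le: "measure_pmf.expectation ?M ?u \<le> exp (\<Sum>e\<in>E. r e * (exp (s e) - 1))" .
  have "measure_pmf.prob ?M {w. c < (\<Sum>e\<in>E. s e * of_bool (w e))} \<le> measure_pmf.prob ?M {w. exp c \<le> ?u w}"
    unfolding u by (intro measure_pmf.finite_measure_mono) auto
  also have "\<dots> \<le> measure_pmf.expectation ?M ?u / exp c"
    using integral_Markov_inequality_measure[of ?M ?u UNIV "exp c"]
    by (simp add: integrable_measure_pmf_finite finite_set_pmf_random_edges E prod_nonneg)
  also have "\<dots> \<le> exp (\<Sum>e\<in>E. r e * (exp (s e) - 1)) / exp c"
    using exp_le by (simp add: divide_right_mono)
  finally show ?thesis by (simp add: exp_diff)
qed

lemma exp_le_quadratic:
  fixes s :: real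
  assumes "\<bar>s\<bar> \<le> 1"
  shows "exp s \<le> 1 + s + s\<^sup>2"
proof (cases "0 \<le> s")
  case True
  then show ?thesis using assms exp_bound[of s] by simp
next
  case False
  have *: "(1 + s + s\<^sup>2) * (1 - s) = 1 + (- s) * s\<^sup>2" by (simp add: algebra_simps power2_eq_square)
  have "1 \<le> (1 + s + s\<^sup>2) * (1 - s)" unfolding * using False by (simp add: mult_nonpos_nonneg)
  also have "\<dots> \<le> (1 + s + s\<^sup>2) * exp (- s)"
    using exp_ge_add_one_self[of "- s"] assms by (intro mult_left_mono) (auto intro: add_nonneg_nonneg)
  finally show ?thesis by (simp add: exp_minus field_simps)
qed

lemma random_edges_bernstein:
  assumes E: "finite E" and r: "\<And>e. e \<in> E \<Longrightarrow> 0 \<le> r e \<and> r e \<le> 1"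
    and s: "\<And>e. e \<in> E \<Longrightarrow> \<bar>s e\<bar> \<le> 1"
  shows "measure_pmf.prob (random_edges E r)
           {w. \<tau> + (\<Sum>e\<in>E. (s e)\<^sup>2 * r e) < (\<Sum>e\<in>E. s e * (of_bool (w e) - r e))} \<le> exp (- \<tau>)"
proof -
  let ?c = "\<tau> + (\<Sum>e\<in>E. (s e)\<^sup>2 * r e) + (\<Sum>e\<in>E. s e * r e)"
  have eq: "{w. \<tau> + (\<Sum>e\<in>E. (s e)\<^sup>2 * r e) < (\<Sum>e\<in>E. s e * (of_bool (w e) - r e))}
      = {w. ?c < (\<Sum>e\<in>E. s e * of_bool (w e))}"
    unfolding right_diff_distrib sum_subtractf by (intro Collect_cong) linarith
  have "(\<Sum>e\<in>E. r e * (exp (s e) - 1)) \<le> (\<Sum>e\<in>E. r e * (s e + (s e)\<^sup>2))"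
  proof (intro sum_mono mult_left_mono)
    fix e assume e: "e \<in> E"
    show "exp (s e) - 1 \<le> s e + (s e)\<^sup>2" using exp_le_quadratic[OF s[OF e]] by linarith
    show "0 \<le> r e" using r[OF e] by simp
  qed
  also have "\<dots> = (\<Sum>e\<in>E. (s e)\<^sup>2 * r e) + (\<Sum>e\<in>E. s e * r e)"
    by (simp add: sum.distrib distrib_left mult.commute)
  finally have "exp ((\<Sum>e\<in>E. r e * (exp (s e) - 1)) - ?c) \<le> exp (- \<tau>)" by simp
  then show ?thesis unfolding eq using random_edges_exp_tail[where r = r and c = ?c and s = s, OF E r] by linarith
qed

text \<open>
The parameter \<open>s = - ln 2\<close> on \<open>F\<close> makes \<open>exp s - 1 = - 1/2\<close>, and \<open>(1 - ln 2) / 2 \<ge> 1/8\<close>.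
\<close>

lemma random_edges_lower_tail:
  assumes E: "finite E" and r: "\<And>e. e \<in> E \<Longrightarrow> 0 \<le> r e \<and> r e \<le> 1"
    and F: "F \<subseteq> E" and \<mu>: "0 \<le> \<mu>" "\<mu> \<le> (\<Sum>e\<in>F. r e)"
  shows "measure_pmf.prob (random_edges E r) {w. (\<Sum>e\<in>F. of_bool (w e)) < \<mu> / 2} \<le> exp (- (\<mu> / 8))"
proof -
  let ?s = "\<lambda>e. if e \<in> F then - ln 2 else (0 :: real)"
  have sum_s: "(\<Sum>e\<in>E. ?s e * of_bool (w e)) = - ln 2 * (\<Sum>e\<in>F. of_bool (w e))" for w
  proof -
    have "(\<Sum>e\<in>E. ?s e * of_bool (w e)) = (\<Sum>e\<in>E. if e \<in> F then - ln 2 * of_bool (w e) else 0)"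
      by (intro sum.cong) auto
    also have "\<dots> = (\<Sum>e\<in>E \<inter> F. - ln 2 * of_bool (w e))" by (simp only: sum.inter_restrict[OF E])
    also have "E \<inter> F = F" using F by auto
    finally show ?thesis by (simp only: sum_distrib_left)
  qed
  have sum_r: "(\<Sum>e\<in>E. r e * (exp (?s e) - 1)) = - (\<Sum>e\<in>F. r e) / 2"
  proof -
    have "(\<Sum>e\<in>E. r e * (exp (?s e) - 1)) = (\<Sum>e\<in>E. if e \<in> F then - (r e / 2) else 0)"
      by (intro sum.cong) (auto simp: exp_minus)
    also have "\<dots> = (\<Sum>e\<in>E \<inter> F. - (r e / 2))" by (simp only: sum.inter_restrict[OF E])
    also have "E \<inter> F = F" using F by auto
    also have "(\<Sum>e\<in>F. - (r e / 2)) = - ((\<Sum>e\<in>F. r e) / 2)" unfolding sum_negf sum_divide_distrib ..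
    finally show ?thesis by simp
  qed
  have "{w. (\<Sum>e\<in>F. of_bool (w e)) < \<mu> / 2} = {w. - ln 2 * (\<mu> / 2) < (\<Sum>e\<in>E. ?s e * of_bool (w e))}"
    unfolding sum_s by simp
  then have "measure_pmf.prob (random_edges E r) {w. (\<Sum>e\<in>F. of_bool (w e)) < \<mu> / 2}
      \<le> exp (- (\<Sum>e\<in>F. r e) / 2 - (- ln 2 * (\<mu> / 2)))"
    using random_edges_exp_tail[where r = r and c = "- ln 2 * (\<mu> / 2)" and s = ?s, OF E r] unfolding sum_r by simp
  also have "\<dots> \<le> exp (- (\<mu> / 8))"
  proof -
    have "ln 2 \<le> (3/4 :: real)" using ln2_le_25_over_36 by simp
    then have "ln 2 * \<mu> \<le> 3/4 * \<mu>" using \<mu> by (intro mult_right_mono)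
    then show ?thesis using \<mu> by simp
  qed
  finally show ?thesis .
qed

lemma random_degree_tail:
  assumes V: "finite V" "E \<subseteq> nsets V 2"
    and r: "\<And>e. e \<in> E \<Longrightarrow> 0 \<le> r e \<and> r e \<le> 1"
    and D: "\<And>v. v \<in> V \<Longrightarrow> (\<Sum>e\<in>{e \<in> E. v \<in> e}. r e) \<le> D"
  shows "measure_pmf.prob (random_edges E r)
           {w. \<exists>v\<in>V. 2 * D + \<tau> < real (card {u \<in> V. {u, v} \<in> {e \<in> E. w e}})} \<le> real (card V) * exp (- \<tau>)"
proof -
  have E: "finite E" using V finite_imp_finite_nsets finite_subset by blast
  have "measure_pmf.prob (random_edges E r)
           {w. \<exists>v\<in>V. 2 * D + \<tau> < real (card {u \<in> V. {u, v} \<in> {e \<in> E. w e}})} \<le> (\<Sum>v\<in>V. exp (- \<tau>))"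
  proof (rule prob_ex_le_sum[OF V(1)])
    fix v assume v: "v \<in> V"
    let ?s = "\<lambda>e. of_bool (v \<in> e) :: real"
    have deg: "real (card {u \<in> V. {u, v} \<in> {e \<in> E. w e}}) = (\<Sum>e\<in>E. ?s e * of_bool (w e))" for w
    proof -
      have "card {u \<in> V. {u, v} \<in> {e \<in> E. w e}} = card {e \<in> {e \<in> E. w e}. v \<in> e}"
        by (rule card_neighbours_eq[OF _ v]) (use V in auto)
      also have "{e \<in> {e \<in> E. w e}. v \<in> e} = {e \<in> E. v \<in> e \<and> w e}" by auto
      also have "real (card \<dots>) = (\<Sum>e\<in>E. of_bool (v \<in> e \<and> w e))"
        using E by (simp add: of_bool_def sum.If_cases Int_def)
      also have "\<dots> = (\<Sum>e\<in>E. ?s e * of_bool (w e))" by (simp add: of_bool_conj)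
      finally show ?thesis .
    qed
    have sr: "(\<Sum>e\<in>E. ?s e * r e) \<le> D"
    proof -
      have "(\<Sum>e\<in>E. ?s e * r e) = (\<Sum>e\<in>{e \<in> E. v \<in> e}. r e)"
        using E by (simp add: of_bool_def sum.inter_filter if_distrib[of "\<lambda>x. x * _"] cong: if_cong)
      then show ?thesis using D[OF v] by simp
    qed
    have sq: "(?s e)\<^sup>2 = ?s e" for e by simp
    have eq: "(\<Sum>e\<in>E. ?s e * (of_bool (w e) - r e)) = (\<Sum>e\<in>E. ?s e * of_bool (w e)) - (\<Sum>e\<in>E. ?s e * r e)" for w
      unfolding right_diff_distrib sum_subtractf ..
    have "measure_pmf.prob (random_edges E r) {w. 2 * D + \<tau> < (\<Sum>e\<in>E. ?s e * of_bool (w e))}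
        \<le> measure_pmf.prob (random_edges E r)
           {w. \<tau> + (\<Sum>e\<in>E. (?s e)\<^sup>2 * r e) < (\<Sum>e\<in>E. ?s e * (of_bool (w e) - r e))}"
      unfolding sq eq using sr by (intro measure_pmf.finite_measure_mono) auto
    also have "\<dots> \<le> exp (- \<tau>)" by (rule random_edges_bernstein[OF E r]) auto
    finally show "measure_pmf.prob (random_edges E r)
        {w. 2 * D + \<tau> < real (card {u \<in> V. {u, v} \<in> {e \<in> E. w e}})} \<le> exp (- \<tau>)"
      unfolding deg .
  qed
  then show ?thesis by simp
qed

text \<open>
Bernstein's inequality for the number of edges between two sets. The sign of \<open>s\<close> selects the upper or the lower
tail. The bound \<open>1/2\<close> on \<open>s\<close> and the factor 2 stem from edges that are counted twice.
\<close>

lemma pairs_bernstein: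
  assumes V: "finite V" "E \<subseteq> nsets V 2" "X \<subseteq> V" "Y \<subseteq> V"
    and r: "\<And>e. e \<in> E \<Longrightarrow> 0 \<le> r e \<and> r e \<le> 1" and s: "\<bar>s\<bar> \<le> 1/2"
  shows "measure_pmf.prob (random_edges E r)
           {w. \<tau> + 2 * s\<^sup>2 * weight (\<lambda>e. of_bool (e \<in> E) * r e) X Y
               < s * (weight (\<lambda>e. of_bool (e \<in> E \<and> w e)) X Y - weight (\<lambda>e. of_bool (e \<in> E) * r e) X Y)}
         \<le> exp (- \<tau>)"
proof -
  have E: "finite E" using V finite_imp_finite_nsets finite_subset by blast
  have fin: "finite X" "finite Y" using V by (auto intro: finite_subset[of _ V])
  define c where "c e = weight (\<lambda>e'. of_bool (e' = e)) X Y" for e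
  have c: "0 \<le> c e" "c e \<le> 2" if "e \<in> E" for e
  proof -
    show "0 \<le> c e" unfolding c_def by (rule weight_nonneg) simp
    show "c e \<le> 2" unfolding c_def by (rule weight_single_edge_le_2[OF fin subsetD[OF V(2) that]])
  qed
  have m: "weight (\<lambda>e. of_bool (e \<in> E) * r e) X Y = (\<Sum>e\<in>E. c e * r e)"
    by (subst weight_eq_sum_edges[OF fin E]) (auto simp: c_def)
  have dev: "s * (weight (\<lambda>e. of_bool (e \<in> E \<and> w e)) X Y - weight (\<lambda>e. of_bool (e \<in> E) * r e) X Y)
      = (\<Sum>e\<in>E. (s * c e) * (of_bool (w e) - r e))" for w
  proof -
    have "weight (\<lambda>e. of_bool (e \<in> E \<and> w e)) X Y - weight (\<lambda>e. of_bool (e \<in> E) * r e) X Y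
        = (\<Sum>e\<in>E. c e * (of_bool (e \<in> E \<and> w e) - of_bool (e \<in> E) * r e))"
      unfolding weight_diff[symmetric] c_def by (rule weight_eq_sum_edges[OF fin E]) auto
    also have "\<dots> = (\<Sum>e\<in>E. c e * (of_bool (w e) - r e))" by (intro sum.cong) auto
    finally show ?thesis by (simp only: sum_distrib_left mult.assoc)
  qed
  have var: "(\<Sum>e\<in>E. (s * c e)\<^sup>2 * r e) \<le> 2 * s\<^sup>2 * weight (\<lambda>e. of_bool (e \<in> E) * r e) X Y"
  proof -
    have "(\<Sum>e\<in>E. (s * c e)\<^sup>2 * r e) \<le> (\<Sum>e\<in>E. 2 * s\<^sup>2 * (c e * r e))"
    proof (intro sum_mono)
      fix e assume e: "e \<in> E"
      have "c e * c e \<le> 2 * c e" using c[OF e] by (intro mult_right_mono) auto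
      then have "s\<^sup>2 * r e * (c e * c e) \<le> s\<^sup>2 * r e * (2 * c e)"
        using r[OF e] by (intro mult_left_mono) auto
      then show "(s * c e)\<^sup>2 * r e \<le> 2 * s\<^sup>2 * (c e * r e)"
        by (simp add: power2_eq_square mult.assoc mult.left_commute mult.commute)
    qed
    then show ?thesis unfolding m by (simp only: sum_distrib_left)
  qed
  have "\<bar>s * c e\<bar> \<le> 1" if "e \<in> E" for e
  proof -
    have "\<bar>s\<bar> * c e \<le> 1/2 * 2" using s c[OF that] by (intro mult_mono) auto
    then show ?thesis using c[OF that] by (simp add: abs_mult)
  qed
  from random_edges_bernstein[where r = r and s = "\<lambda>e. s * c e" and \<tau> = \<tau>, OF E r this]
  have b: "measure_pmf.prob (random_edges E r)
           {w. \<tau> + (\<Sum>e\<in>E. (s * c e)\<^sup>2 * r e) < (\<Sum>e\<in>E. s * c e * (of_bool (w e) - r e))} \<le> exp (- \<tau>)"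
    by blast
  show ?thesis
    by (rule order_trans[OF _ b], unfold dev, intro measure_pmf.finite_measure_mono)
      (use var in auto)
qed

lemma four_power_le_exp: "(4::real) ^ k \<le> exp (2 * real k)"
proof -
  have "(2::real) \<le> exp 1" using exp_ge_add_one_self[of 1] by simp
  then have "(2::real) ^ (2 * k) \<le> exp 1 ^ (2 * k)" by (intro power_mono) auto
  also have "\<dots> = exp (2 * real k)" by (simp flip: exp_of_nat_mult)
  finally show ?thesis by (simp add: power_mult)
qed

section \<open>Pairs with a large main term\<close>

text \<open>
The variance is of the order of \<open>A\<close> times the area, so a deviation of order \<open>\<sigma>\<close> times the square root of the
area has an exponent of order \<open>\<sigma>\<^sup>2 / A\<close>. This is at least both \<open>card V\<close>, which pays for all \<open>4 ^ card V\<close>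
pairs, and \<open>L\<close>.
\<close>

lemma dense_pairs_tail:
  assumes V: "finite V" "E \<subseteq> nsets V 2"
    and r: "\<And>e. e \<in> E \<Longrightarrow> 0 \<le> r e \<and> r e \<le> 1"
    and A: "0 \<le> A" "A \<le> 1" "A * real (card V) \<le> \<sigma>\<^sup>2" and \<sigma>: "0 < \<sigma>"
    and K: "0 \<le> K" and L: "0 \<le> L" "L \<le> \<sigma>\<^sup>2"
  defines "m \<equiv> weight (\<lambda>e. of_bool (e \<in> E) * r e)"
  shows "measure_pmf.prob (random_edges E r)
           {w. \<exists>X Y. X \<subseteq> V \<and> Y \<subseteq> V \<and> 2 * \<sigma> \<le> A * sqrt (real (card X) * real (card Y)) \<and>
                 m X Y \<le> 2 * A * (real (card X) * real (card Y)) \<and>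
                 (6 + K) * \<sigma> * sqrt (real (card X) * real (card Y))
                   < \<bar>weight (\<lambda>e. of_bool (e \<in> E \<and> w e)) X Y - m X Y\<bar>}
         \<le> 2 * exp (- (K * L))"
proof -
  \<comment> \<open>The first summand pays for the union bound, the second is the final exponent.\<close>
  define \<tau> where "\<tau> = 2 * real (card V) + K * L"
  let ?S = "\<lambda>Z. sqrt (real (card (fst Z)) * real (card (snd Z)))"
  let ?I = "{Z \<in> Pow V \<times> Pow V. 2 * \<sigma> \<le> A * ?S Z \<and> m (fst Z) (snd Z) \<le> 2 * A * (real (card (fst Z)) * real (card (snd Z)))}"
  let ?dev = "\<lambda>w Z. weight (\<lambda>e. of_bool (e \<in> E \<and> w e)) (fst Z) (snd Z) - m (fst Z) (snd Z)"
  have finI: "finite (Pow V \<times> Pow V)" using V by simp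
  have \<tau>A: "\<tau> * A \<le> (2 + K) * \<sigma>\<^sup>2"
  proof -
    have "L * A \<le> L * 1" using A L by (intro mult_left_mono) auto
    then have "K * (L * A) \<le> K * \<sigma>\<^sup>2" using K L by (intro mult_left_mono) auto
    then show ?thesis using A unfolding \<tau>_def by (simp add: algebra_simps)
  qed
  have one: "measure_pmf.prob (random_edges E r) {w. (6 + K) * \<sigma> * ?S Z < \<bar>?dev w Z\<bar>} \<le> 2 * exp (- \<tau>)"
    if Z: "Z \<in> ?I" for Z
  proof -
    define S where "S = ?S Z"
    have AS: "2 * \<sigma> \<le> A * S" using Z unfolding S_def by simp
    then have AS0: "0 < A * S" using \<sigma> by linarith
    then have S0: "0 < S" using A by (simp add: zero_less_mult_iff)
    have A0: "0 < A" using AS0 A by (simp add: zero_less_mult_iff)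
    have mS: "m (fst Z) (snd Z) \<le> 2 * A * S\<^sup>2" using Z unfolding S_def by simp
    \<comment> \<open>This choice balances the two error terms \<open>\<tau> / s\<close> and \<open>2 s m\<close>, both of order \<open>\<sigma> S\<close>.\<close>
    define s where "s = \<sigma> / (A * S)"
    have s: "0 < s" "s \<le> 1/2" unfolding s_def using AS AS0 \<sigma> by (auto simp: field_simps)
    have bound: "\<tau> + 2 * s\<^sup>2 * m (fst Z) (snd Z) \<le> s * ((6 + K) * \<sigma> * S)"
    proof -
      have "2 * s\<^sup>2 * m (fst Z) (snd Z) \<le> 2 * s\<^sup>2 * (2 * A * S\<^sup>2)"
        using mS by (intro mult_left_mono) auto
      also have "\<dots> = 4 * \<sigma>\<^sup>2 / A"
        unfolding s_def using A0 S0 by (simp add: field_simps power2_eq_square)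
      finally have 1: "2 * s\<^sup>2 * m (fst Z) (snd Z) \<le> 4 * \<sigma>\<^sup>2 / A" .
      have 2: "\<tau> \<le> (2 + K) * \<sigma>\<^sup>2 / A" using \<tau>A A0 by (simp add: field_simps)
      have "s * ((6 + K) * \<sigma> * S) = (6 + K) * \<sigma>\<^sup>2 / A"
        unfolding s_def using A0 S0 by (simp add: field_simps power2_eq_square)
      also have "\<dots> = 4 * \<sigma>\<^sup>2 / A + (2 + K) * \<sigma>\<^sup>2 / A"
        by (simp add: add_divide_distrib[symmetric] distrib_right[symmetric])
      finally show ?thesis using 1 2 by linarith
    qed
    have fZ: "fst Z \<subseteq> V" "snd Z \<subseteq> V" using Z by auto
    have tail: "measure_pmf.prob (random_edges E r)
        {w. \<tau> + 2 * t\<^sup>2 * m (fst Z) (snd Z) < t * ?dev w Z} \<le> exp (- \<tau>)" if "\<bar>t\<bar> \<le> 1/2" for t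
      using pairs_bernstein[where r = r and \<tau> = \<tau>, OF V fZ r that] unfolding m_def by blast
    have "measure_pmf.prob (random_edges E r) {w. (6 + K) * \<sigma> * S < \<bar>?dev w Z\<bar>}
        \<le> measure_pmf.prob (random_edges E r)
            ({w. \<tau> + 2 * s\<^sup>2 * m (fst Z) (snd Z) < s * ?dev w Z} \<union>
             {w. \<tau> + 2 * (- s)\<^sup>2 * m (fst Z) (snd Z) < (- s) * ?dev w Z})"
    proof (intro measure_pmf.finite_measure_mono subsetI)
      fix w assume "w \<in> {w. (6 + K) * \<sigma> * S < \<bar>?dev w Z\<bar>}"
      then have "s * ((6 + K) * \<sigma> * S) < s * \<bar>?dev w Z\<bar>" using s by simp
      then have lt: "\<tau> + 2 * s\<^sup>2 * m (fst Z) (snd Z) < s * \<bar>?dev w Z\<bar>" using bound by linarith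
      show "w \<in> {w. \<tau> + 2 * s\<^sup>2 * m (fst Z) (snd Z) < s * ?dev w Z} \<union>
             {w. \<tau> + 2 * (- s)\<^sup>2 * m (fst Z) (snd Z) < (- s) * ?dev w Z}"
      proof (cases "0 \<le> ?dev w Z")
        case True
        then have "\<bar>?dev w Z\<bar> = ?dev w Z" by simp
        then show ?thesis using lt by simp
      next
        case False
        then have "\<bar>?dev w Z\<bar> = - ?dev w Z" by simp
        then show ?thesis using lt by (simp add: right_diff_distrib)
      qed
    qed simp
    also have "\<dots> \<le> exp (- \<tau>) + exp (- \<tau>)"
      using tail[of s] tail[of "- s"] s
        measure_Un_le[of "{w. \<tau> + 2 * s\<^sup>2 * m (fst Z) (snd Z) < s * ?dev w Z}" "measure_pmf (random_edges E r)"
          "{w. \<tau> + 2 * (- s)\<^sup>2 * m (fst Z) (snd Z) < (- s) * ?dev w Z}"] by simp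
    finally show ?thesis unfolding S_def by simp
  qed
  have "measure_pmf.prob (random_edges E r) {w. \<exists>Z\<in>?I. (6 + K) * \<sigma> * ?S Z < \<bar>?dev w Z\<bar>}
      \<le> (\<Sum>Z\<in>?I. 2 * exp (- \<tau>))"
    using finI by (intro prob_ex_le_sum one) (auto intro: finite_subset[of _ "Pow V \<times> Pow V"])
  also have "\<dots> \<le> (\<Sum>Z\<in>Pow V \<times> Pow V. 2 * exp (- \<tau>))"
    using finI by (intro sum_mono2) auto
  also have "\<dots> = 2 * (4 ^ card V * exp (- \<tau>))"
    using V by (simp add: card_cartesian_product card_Pow flip: power_mult_distrib)
  also have "\<dots> \<le> 2 * (exp (2 * real (card V)) * exp (- \<tau>))"
    by (intro mult_left_mono mult_right_mono four_power_le_exp) auto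
  also have "\<dots> = 2 * exp (- (K * L))" unfolding \<tau>_def by (simp flip: exp_add)
  finally show ?thesis
    by (rule order_trans[rotated]) (intro measure_pmf.finite_measure_mono, auto)
qed

section \<open>Pairs inside the neighbourhood of a seed set\<close>

definition nbhd :: "'v set set \<Rightarrow> 'v set \<Rightarrow> 'v set" where
  "nbhd J W = {v. \<exists>w\<in>W. {v, w} \<in> J}"

text \<open>
The exponent in the Bernstein bound for the edges that avoid \<open>W\<close>, as a function of the outcome.
\<close>

definition seed_excess ::
    "'v set set \<Rightarrow> ('v set \<Rightarrow> real) \<Rightarrow> 'v set \<Rightarrow> real \<Rightarrow> ('v set \<Rightarrow> bool) \<Rightarrow> 'v set \<Rightarrow> 'v set \<Rightarrow> real" where
  "seed_excess E r W s w X Y =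
     s * (weight (\<lambda>e. of_bool (e \<in> E \<and> w e \<and> e \<inter> W = {})) X Y - weight (\<lambda>e. of_bool (e \<in> E \<and> e \<inter> W = {}) * r e) X Y)
       - 2 * s\<^sup>2 * weight (\<lambda>e. of_bool (e \<in> E \<and> e \<inter> W = {}) * r e) X Y"

text \<open>
The neighbourhood of \<open>W\<close> is determined by the edges that meet \<open>W\<close>, and the excess by the other edges, which are
independent of the former. After the edges at \<open>W\<close> are revealed, the sets \<open>X\<close> and \<open>Y\<close> range over the subsets of a fixed
set \<open>N\<close>, and the term \<open>2 (card N)\<close> pays for these at most \<open>4 ^ card N\<close> pairs.
\<close>

lemma seed_excess_tail:
  assumes V: "finite V" "E \<subseteq> nsets V 2" "W \<subseteq> V"
    and r: "\<And>e. e \<in> E \<Longrightarrow> 0 \<le> r e \<and> r e \<le> 1" and s: "\<bar>s\<bar> \<le> 1/2"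
  shows "measure_pmf.prob (random_edges E r)
           {w. \<exists>X Y. X \<subseteq> V \<inter> nbhd {e \<in> E. w e} W \<and> Y \<subseteq> V \<inter> nbhd {e \<in> E. w e} W \<and>
                 2 * real (card (V \<inter> nbhd {e \<in> E. w e} W)) + \<tau> < seed_excess E r W s w X Y}
         \<le> exp (- \<tau>)"
proof -
  have E: "finite E" using V finite_imp_finite_nsets finite_subset by blast
  define E1 where "E1 = {e \<in> E. e \<inter> W \<noteq> {}}"
  define E2 where "E2 = {e \<in> E. e \<inter> W = {}}"
  have E12: "E1 \<union> E2 = E" "E1 \<inter> E2 = {}" "finite E1" "finite E2" "E2 \<subseteq> nsets V 2"
    using E V unfolding E1_def E2_def by auto
  let ?N = "\<lambda>f. V \<inter> nbhd {e \<in> E1. f e} W"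
  let ?m = "\<lambda>X Y. weight (\<lambda>e. of_bool (e \<in> E2) * r e) X Y"
  let ?bad = "\<lambda>f g. \<exists>Z\<in>Pow (?N f) \<times> Pow (?N f).
      (2 * real (card (?N f)) + \<tau>) + 2 * s\<^sup>2 * ?m (fst Z) (snd Z)
        < s * (weight (\<lambda>e. of_bool (e \<in> E2 \<and> g e)) (fst Z) (snd Z) - ?m (fst Z) (snd Z))"
  let ?h = "\<lambda>(f, g) x. if x \<in> E1 then f x else g x"
  have bad_le: "measure_pmf.prob (random_edges E2 r) {g. ?bad f g} \<le> exp (- \<tau>)" for f
  proof -
    have finN: "finite (?N f)" using V by simp
    have "measure_pmf.prob (random_edges E2 r) {g. ?bad f g}
        \<le> (\<Sum>Z\<in>Pow (?N f) \<times> Pow (?N f). exp (- (2 * real (card (?N f)) + \<tau>)))"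
    proof (rule prob_ex_le_sum)
      fix Z assume Z: "Z \<in> Pow (?N f) \<times> Pow (?N f)"
      then have "fst Z \<subseteq> V" "snd Z \<subseteq> V" by auto
      then show "measure_pmf.prob (random_edges E2 r)
           {g. (2 * real (card (?N f)) + \<tau>) + 2 * s\<^sup>2 * ?m (fst Z) (snd Z)
              < s * (weight (\<lambda>e. of_bool (e \<in> E2 \<and> g e)) (fst Z) (snd Z) - ?m (fst Z) (snd Z))}
           \<le> exp (- (2 * real (card (?N f)) + \<tau>))"
        using r s by (intro pairs_bernstein[OF V(1) E12(5)]) (auto simp: E2_def)
    qed (use finN in \<open>intro finite_cartesian_product; simp only: finite_Pow_iff\<close>)
    also have "\<dots> = 4 ^ card (?N f) * exp (- (2 * real (card (?N f)) + \<tau>))"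
    proof -
      have "card (Pow (?N f) \<times> Pow (?N f)) = 4 ^ card (?N f)"
        unfolding card_cartesian_product card_Pow[OF finN] by (simp flip: power_mult_distrib)
      then show ?thesis by (simp only: sum_constant of_nat_power of_nat_numeral)
    qed
    also have "\<dots> \<le> exp (2 * real (card (?N f))) * exp (- (2 * real (card (?N f)) + \<tau>))"
      by (intro mult_right_mono four_power_le_exp) simp
    also have "\<dots> = exp (- \<tau>)" by (simp flip: exp_add)
    finally show ?thesis .
  qed
  have split: "random_edges E r = map_pmf ?h (pair_pmf (random_edges E1 r) (random_edges E2 r))"
    unfolding random_edges_def E12(1)[symmetric] by (rule Pi_pmf_union[OF E12(3,4,2)])
  have N_eq: "V \<inter> nbhd {e \<in> E. ?h (f, g) e} W = ?N f" for f g
    unfolding nbhd_def E1_def by auto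
  have weight_g: "weight (\<lambda>e. of_bool (e \<in> E \<and> ?h (f, g) e \<and> e \<inter> W = {})) X Y
      = weight (\<lambda>e. of_bool (e \<in> E2 \<and> g e)) X Y" for f g X Y
  proof -
    have "(\<lambda>e. of_bool (e \<in> E \<and> ?h (f, g) e \<and> e \<inter> W = {}) :: real) = (\<lambda>e. of_bool (e \<in> E2 \<and> g e))"
      unfolding E1_def E2_def by (intro ext) auto
    then show ?thesis by simp
  qed
  have E2_iff: "e \<in> E \<and> e \<inter> W = {} \<longleftrightarrow> e \<in> E2" for e unfolding E2_def by simp
  have "{w. \<exists>X Y. X \<subseteq> V \<inter> nbhd {e \<in> E. w e} W \<and> Y \<subseteq> V \<inter> nbhd {e \<in> E. w e} W \<and>
                 2 * real (card (V \<inter> nbhd {e \<in> E. w e} W)) + \<tau> < seed_excess E r W s w X Y}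
    = {w. \<exists>X Y. X \<subseteq> V \<inter> nbhd {e \<in> E. w e} W \<and> Y \<subseteq> V \<inter> nbhd {e \<in> E. w e} W \<and>
                 2 * real (card (V \<inter> nbhd {e \<in> E. w e} W)) + \<tau> + 2 * s\<^sup>2 * ?m X Y
                  < s * (weight (\<lambda>e. of_bool (e \<in> E \<and> w e \<and> e \<inter> W = {})) X Y - ?m X Y)}" (is "?L = {w. ?B w}")
    unfolding seed_excess_def E2_iff less_diff_eq ..
  moreover have "?B (?h z) \<longleftrightarrow> ?bad (fst z) (snd z)" for z
  proof -
    obtain f g where z: "z = (f, g)" by fastforce
    show ?thesis unfolding z N_eq weight_g fst_conv snd_conv by (auto simp: Bex_def)
  qed
  then have "?h -` {w. ?B w} = {z. ?bad (fst z) (snd z)}" unfolding vimage_def mem_Collect_eq by (intro Collect_cong)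
  ultimately show ?thesis
    unfolding split measure_map_pmf using prob_pair_pmf_le[of "random_edges E2 r" ?bad, OF bad_le, of "random_edges E1 r"] by simp
qed

lemma sum_Pow_power_card:
  fixes z :: real
  assumes "finite V"
  shows "(\<Sum>W\<in>Pow V. z ^ card W) = (1 + z) ^ card V"
  using prod_add[OF assms, of "\<lambda>_. z" "\<lambda>_. 1"] by (simp add: add.commute)

text \<open>
The term \<open>K L (card W)\<close> pays for the choice of \<open>W\<close>, since the sum of \<open>(2 n) powr (- K (card W))\<close> over the nonempty
\<open>W \<subseteq> V\<close> is of order \<open>n powr (1 - K)\<close>. Allowing this term to grow with \<open>W\<close> is what keeps
the loss proportional to the size of the seed set.
\<close>

lemma seed_excess_tail_all:
  assumes V: "finite V" "V \<noteq> {}" "E \<subseteq> nsets V 2"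
    and r: "\<And>e. e \<in> E \<Longrightarrow> 0 \<le> r e \<and> r e \<le> 1" and s: "\<bar>s\<bar> \<le> 1/2" and K: "1 \<le> K"
  defines "L \<equiv> ln (2 * real (card V))"
  shows "measure_pmf.prob (random_edges E r)
           {w. \<exists>W\<in>Pow V - {{}}. \<exists>X Y. X \<subseteq> V \<inter> nbhd {e \<in> E. w e} W \<and> Y \<subseteq> V \<inter> nbhd {e \<in> E. w e} W \<and>
                 2 * real (card (V \<inter> nbhd {e \<in> E. w e} W)) + K * L * real (card W) < seed_excess E r W s w X Y}
         \<le> exp (- ((K - 1) * L))"
proof -
  define n where "n = card V"
  have n: "n \<ge> 1" using V by (simp add: n_def Suc_leI card_gt_0_iff)
  define z where "z = exp (- (K * L))"
  have "exp L = 2 * real n" using n unfolding L_def n_def by simp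
  moreover have "0 \<le> L" using n unfolding L_def n_def by simp
  ultimately have L: "exp L = 2 * real n" "0 \<le> L" by auto
  \<comment> \<open>\<open>z\<close> is the price of one vertex of \<open>W\<close>.\<close>
  have nz: "2 * real n * z = exp (- ((K - 1) * L))"
    unfolding z_def L(1)[symmetric] by (simp flip: exp_add add: algebra_simps)
  have "exp (- ((K - 1) * L)) \<le> 1" using K L by simp
  then have "2 * (real n * z) \<le> 1" using nz by linarith
  moreover have nz0: "0 \<le> real n * z" unfolding z_def by simp
  ultimately have nz1: "0 \<le> real n * z" "real n * z \<le> 1" by linarith+
  have "measure_pmf.prob (random_edges E r)
           {w. \<exists>W\<in>Pow V - {{}}. \<exists>X Y. X \<subseteq> V \<inter> nbhd {e \<in> E. w e} W \<and> Y \<subseteq> V \<inter> nbhd {e \<in> E. w e} W \<and>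
                 2 * real (card (V \<inter> nbhd {e \<in> E. w e} W)) + K * L * real (card W) < seed_excess E r W s w X Y}
      \<le> (\<Sum>W\<in>Pow V - {{}}. z ^ card W)"
  proof (rule prob_ex_le_sum)
    fix W assume "W \<in> Pow V - {{}}"
    then have W: "W \<subseteq> V" by simp
    have "exp (- (K * L * real (card W))) = z ^ card W"
      unfolding z_def by (simp add: mult.commute flip: exp_of_nat_mult)
    then show "measure_pmf.prob (random_edges E r)
           {w. \<exists>X Y. X \<subseteq> V \<inter> nbhd {e \<in> E. w e} W \<and> Y \<subseteq> V \<inter> nbhd {e \<in> E. w e} W \<and>
                 2 * real (card (V \<inter> nbhd {e \<in> E. w e} W)) + K * L * real (card W) < seed_excess E r W s w X Y}
         \<le> z ^ card W"
      using seed_excess_tail[where r = r and \<tau> = "K * L * real (card W)", OF V(1,3) W r s] by simp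
  qed (use V in simp)
  also have "\<dots> = (1 + z) ^ n - 1"
    using V by (simp add: sum_diff1 sum_Pow_power_card n_def)
  also have "(1 + z) ^ n \<le> exp z ^ n"
    using exp_ge_add_one_self[of z] by (intro power_mono) (auto simp: z_def)
  also have "exp z ^ n = exp (real n * z)" by (simp flip: exp_of_nat_mult)
  also have "\<dots> \<le> 1 + real n * z + (real n * z)\<^sup>2" using nz1 by (rule exp_bound)
  also have "(real n * z)\<^sup>2 \<le> real n * z" using nz1 by (simp add: power2_eq_square mult_left_le)
  finally show ?thesis using nz by linarith
qed

section \<open>From seed sets to all sparse pairs\<close>

text \<open>
Greedy choice: as long as more than \<open>\<kappa>\<close> elements of \<open>Y\<close> have no neighbour in \<open>T\<close>, some \<open>x\<close> is related to at least
\<open>\<kappa> l / card X\<close> of them. So a largest \<open>T\<close> that covers at least \<open>\<kappa> l / card X\<close> elements per member is as required.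
\<close>

lemma seed_set_exists:
  fixes R :: "'a \<Rightarrow> 'b \<Rightarrow> bool" and l \<kappa> :: real
  assumes X: "finite X" and Y: "finite Y" and l: "0 < l" and \<kappa>: "0 < \<kappa>"
    and deg: "\<And>y. y \<in> Y \<Longrightarrow> l \<le> real (card {x \<in> X. R x y})"
  obtains T where "T \<subseteq> X" "real (card T) * (\<kappa> * l) \<le> real (card X) * real (card Y)"
    "real (card {y \<in> Y. \<forall>x\<in>T. \<not> R x y}) \<le> \<kappa>"
proof -
  define cov where "cov T = {y \<in> Y. \<exists>x\<in>T. R x y}" for T
  define P where "P T \<longleftrightarrow> T \<subseteq> X \<and> real (card T) * (\<kappa> * l) \<le> real (card X) * real (card (cov T))" for T
  have "P {}" unfolding P_def by simp
  moreover have "\<forall>T. P T \<longrightarrow> card T \<le> card X" unfolding P_def using card_mono[OF X] by blast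
  ultimately have "\<exists>T. P T \<and> (\<forall>T'. P T' \<longrightarrow> card T' \<le> card T)"
    using ex_has_greatest_nat[of P "{}" card "Suc (card X)"] by (auto simp: less_Suc_eq_le)
  then obtain T where T: "P T" and T_max: "\<And>T'. P T' \<Longrightarrow> card T' \<le> card T"
    by blast
  define U where "U = {y \<in> Y. \<forall>x\<in>T. \<not> R x y}"
  have fin: "finite U" "finite (cov T)" "finite T"
    using X Y T finite_subset unfolding U_def cov_def P_def by auto
  have U_le: "real (card U) \<le> \<kappa>"
  proof (rule ccontr)
    assume "\<not> real (card U) \<le> \<kappa>"
    then have U: "\<kappa> < real (card U)" by simp
    have "\<kappa> * l < real (card U) * l" using U l by simp
    also have "\<dots> \<le> (\<Sum>y\<in>U. real (card {x \<in> X. R x y}))"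
      using sum_mono[of U "\<lambda>_. l" "\<lambda>y. real (card {x \<in> X. R x y})"] deg unfolding U_def by simp
    also have "\<dots> = (\<Sum>x\<in>X. real (card {y \<in> U. R x y}))"
    proof -
      have "(\<Sum>y\<in>U. \<Sum>x\<in>X. of_bool (R x y)) = (\<Sum>x\<in>X. \<Sum>y\<in>U. of_bool (R x y) :: real)"
        by (rule sum.swap)
      then show ?thesis using X fin by (simp add: of_bool_def sum.If_cases Int_def)
    qed
    finally have sum: "\<kappa> * l < (\<Sum>x\<in>X. real (card {y \<in> U. R x y}))" .
    then have Xne: "X \<noteq> {}" using l \<kappa> by (metis mult_pos_pos not_less_iff_gr_or_eq sum.empty)
    have "\<exists>x\<in>X. \<kappa> * l \<le> real (card X) * real (card {y \<in> U. R x y})"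
    proof (rule ccontr)
      assume "\<not> ?thesis"
      then have "\<And>x. x \<in> X \<Longrightarrow> real (card X) * real (card {y \<in> U. R x y}) < \<kappa> * l" by force
      then have "(\<Sum>x\<in>X. real (card X) * real (card {y \<in> U. R x y})) < (\<Sum>x\<in>X. \<kappa> * l)"
        using X Xne by (intro sum_strict_mono)
      then have "real (card X) * (\<Sum>x\<in>X. real (card {y \<in> U. R x y})) < real (card X) * (\<kappa> * l)"
        by (simp add: sum_distrib_left)
      then show False using sum mult_less_cancel_left_pos[of "real (card X)"] X Xne by (simp add: card_gt_0_iff)
    qed
    then obtain x where x: "x \<in> X" "\<kappa> * l \<le> real (card X) * real (card {y \<in> U. R x y})" by blast
    have "{y \<in> U. R x y} \<noteq> {}" using x(2) l \<kappa> by (metis card.empty mult_pos_pos mult_zero_right not_le of_nat_0)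
    then have "x \<notin> T" unfolding U_def by blast
    have "cov (insert x T) = cov T \<union> {y \<in> U. R x y}" unfolding cov_def U_def by blast
    moreover have "cov T \<inter> {y \<in> U. R x y} = {}" unfolding cov_def U_def by blast
    ultimately have "card (cov (insert x T)) = card (cov T) + card {y \<in> U. R x y}"
      using fin by (simp add: card_Un_disjoint)
    then have "P (insert x T)"
      using T x \<open>x \<notin> T\<close> fin unfolding P_def by (simp add: algebra_simps)
    then show False using T_max[of "insert x T"] \<open>x \<notin> T\<close> fin by simp
  qed
  have "real (card X) * real (card (cov T)) \<le> real (card X) * real (card Y)"
    
  proof (intro mult_left_mono)
    have "cov T \<subseteq> Y" unfolding cov_def by blast
    then show "real (card (cov T)) \<le> real (card Y)" using Y by (simp add: card_mono)
  qed simp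
  then have T_le: "real (card T) * (\<kappa> * l) \<le> real (card X) * real (card Y)"
    using T unfolding P_def by linarith
  have "T \<subseteq> X" using T unfolding P_def by simp
  then show ?thesis using T_le U_le unfolding U_def by (rule that)
qed

text \<open>
Here \<open>p\<close> and \<open>q\<close> stand for the square roots of (upper bounds on) the two sizes. The set \<open>Y\<close> splits into vertices of low degree
into \<open>X\<close>, which contribute at most \<open>\<sigma> p q\<close> edges altogether, the part \<open>Y'\<close> adjacent to the seed set \<open>T\<close>, and a
remainder \<open>R\<close> of at most a sixteenth of the size.
\<close>

lemma hit_part_extraction:
  fixes p q \<sigma> :: real
  assumes X: "finite X" "real (card X) \<le> p\<^sup>2" and Y: "finite Y" "real (card Y) \<le> q\<^sup>2"
    and pos: "0 < p" "0 < q" "0 < \<sigma>"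
  obtains T Y' R where "T \<subseteq> X" "real (card T) * \<sigma> \<le> 16 * (p * q)"
    "Y' \<subseteq> Y" "R \<subseteq> Y" "Y' \<inter> R = {}" "\<And>y. y \<in> Y' \<Longrightarrow> \<exists>x\<in>T. {x, y} \<in> J"
    "real (card R) \<le> q\<^sup>2 / 16"
    "weight (\<lambda>e. of_bool (e \<in> J)) X Y
       \<le> \<sigma> * (p * q) + weight (\<lambda>e. of_bool (e \<in> J)) X Y' + weight (\<lambda>e. of_bool (e \<in> J)) X R"
proof -
  \<comment> \<open>The degree threshold, chosen so that \<open>l * q\<^sup>2 = \<sigma> * (p * q)\<close>.\<close>
  define l where "l = \<sigma> * p / q"
  have l: "0 < l" using pos by (simp add: l_def)
  define H where "H = {y \<in> Y. l \<le> real (card {x \<in> X. {x, y} \<in> J})}"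
  have H: "finite H" "H \<subseteq> Y" using Y unfolding H_def by auto
  have "0 < q\<^sup>2 / 16" using pos by simp
  moreover have "\<And>y. y \<in> H \<Longrightarrow> l \<le> real (card {x \<in> X. {x, y} \<in> J})" unfolding H_def by simp
  ultimately obtain T where T: "T \<subseteq> X" "real (card T) * (q\<^sup>2 / 16 * l) \<le> real (card X) * real (card H)"
    "real (card {y \<in> H. \<forall>x\<in>T. {x, y} \<notin> J}) \<le> q\<^sup>2 / 16"
    using seed_set_exists[OF X(1) H(1) l, of "q\<^sup>2 / 16" "\<lambda>x y. {x, y} \<in> J"] by blast
  define Y' where "Y' = {y \<in> H. \<exists>x\<in>T. {x, y} \<in> J}"
  define R where "R = {y \<in> H. \<forall>x\<in>T. {x, y} \<notin> J}"
  have HYR: "H = Y' \<union> R" "Y' \<inter> R = {}" "finite Y'" "finite R"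
    using H unfolding Y'_def R_def by auto
  have "card H \<le> card Y" using H Y by (simp add: card_mono)
  then have "real (card X) * real (card H) \<le> p\<^sup>2 * q\<^sup>2"
    using X Y by (intro mult_mono) auto
  then have "real (card T) * (q\<^sup>2 / 16 * l) \<le> p\<^sup>2 * q\<^sup>2" using T(2) by linarith
  then have "real (card T) * \<sigma> * (p * q) \<le> 16 * (p * q) * (p * q)"
    using pos unfolding l_def by (simp add: field_simps power2_eq_square)
  then have cT: "real (card T) * \<sigma> \<le> 16 * (p * q)"
    using pos by simp
  have "weight (\<lambda>e. of_bool (e \<in> J)) X (Y - H) \<le> l * real (card (Y - H))"
    by (intro weight_of_bool_le) (use X Y in \<open>auto simp: H_def\<close>)
  also have "\<dots> \<le> l * q\<^sup>2"
  proof -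
    have "card (Y - H) \<le> card Y" using Y by (simp add: card_mono)
    then show ?thesis using Y l by (intro mult_left_mono) auto
  qed
  also have "\<dots> = \<sigma> * (p * q)" unfolding l_def using pos by (simp add: power2_eq_square)
  finally have low: "weight (\<lambda>e. of_bool (e \<in> J)) X (Y - H) \<le> \<sigma> * (p * q)" .
  have "weight (\<lambda>e. of_bool (e \<in> J)) X Y = weight (\<lambda>e. of_bool (e \<in> J)) X ((Y - H) \<union> (Y' \<union> R))"
  proof -
    have "Y = (Y - H) \<union> (Y' \<union> R)" using HYR(1) H(2) by auto
    then show ?thesis by simp
  qed
  also have "\<dots> = weight (\<lambda>e. of_bool (e \<in> J)) X (Y - H) + (weight (\<lambda>e. of_bool (e \<in> J)) X Y' + weight (\<lambda>e. of_bool (e \<in> J)) X R)"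
  proof -
    have "(Y - H) \<inter> (Y' \<union> R) = {}" using HYR(1) by auto
    then show ?thesis
      using weight_Un_right[of "Y - H" "Y' \<union> R"] weight_Un_right[OF HYR(3,4,2)] HYR Y(1) by simp
  qed
  finally have total: "weight (\<lambda>e. of_bool (e \<in> J)) X Y
       \<le> \<sigma> * (p * q) + weight (\<lambda>e. of_bool (e \<in> J)) X Y' + weight (\<lambda>e. of_bool (e \<in> J)) X R"
    using low by simp
  have sub: "Y' \<subseteq> Y" "R \<subseteq> Y" using H HYR by auto
  have hit: "\<And>y. y \<in> Y' \<Longrightarrow> \<exists>x\<in>T. {x, y} \<in> J" unfolding Y'_def by simp
  have cR: "real (card R) \<le> q\<^sup>2 / 16" using T(3) unfolding R_def .
  show ?thesis
    by (rule that[OF T(1) cT sub HYR(2) hit cR total])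
qed

lemma weight_meeting_le:
  assumes V: "finite V" "W \<subseteq> V" "X \<subseteq> V" "Y \<subseteq> V"
    and deg: "\<And>v. v \<in> V \<Longrightarrow> real (card {u \<in> V. {u, v} \<in> J}) \<le> \<Delta>"
  shows "weight (\<lambda>e. of_bool (e \<in> J)) X Y
           \<le> weight (\<lambda>e. of_bool (e \<in> J \<and> e \<inter> W = {})) X Y + 2 * \<Delta> * real (card W)"
proof -
  let ?j = "\<lambda>e. of_bool (e \<in> J) :: real"
  have fin: "finite X" "finite Y" "finite W" using V by (auto intro: finite_subset[of _ V])
  have half: "weight ?j X (Y \<inter> W) \<le> \<Delta> * real (card W)" if "X \<subseteq> V" "Y \<subseteq> V" for X Y
  proof (cases "W = {}")
    case False
    then obtain v where v: "v \<in> V" using V by auto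
    have fX: "finite X" using that V finite_subset by blast
    have "weight ?j X (Y \<inter> W) \<le> \<Delta> * real (card (Y \<inter> W))"
    proof (intro weight_of_bool_le)
      fix y assume "y \<in> Y \<inter> W"
      then have "card {x \<in> X. {x, y} \<in> J} \<le> card {u \<in> V. {u, y} \<in> J}"
        using that V by (intro card_mono) auto
      then show "real (card {x \<in> X. {x, y} \<in> J}) \<le> \<Delta>"
        using deg[of y] \<open>y \<in> Y \<inter> W\<close> V by force
    qed (use fX fin in auto)
    also have "\<dots> \<le> \<Delta> * real (card W)"
    proof (intro mult_left_mono)
      show "real (card (Y \<inter> W)) \<le> real (card W)" using fin by (simp add: card_mono)
      show "0 \<le> \<Delta>" using deg[OF v] by linarith
    qed
    finally show ?thesis .
  qed simp
  have "weight ?j X Y \<le> weight (\<lambda>e. of_bool (e \<in> J \<and> e \<inter> W = {})) X Y + (weight ?j X (Y \<inter> W) + weight ?j (X \<inter> W) Y)"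
    by (rule weight_le_meeting[OF fin(1,2)]) auto
  moreover have "weight ?j X (Y \<inter> W) \<le> \<Delta> * real (card W)" by (rule half) fact+
  moreover have "weight ?j (X \<inter> W) Y \<le> \<Delta> * real (card W)"
    using half[of Y X] V by (subst weight_commute) simp
  ultimately show ?thesis by linarith
qed

text \<open>
Deterministic half of the concentration argument. Split \<open>Y\<close> by \<open>hit_part_extraction\<close>, then split \<open>X\<close> with respect to
the hit part of \<open>Y\<close>. The two hit parts lie in the neighbourhood of \<open>W = T \<union> T'\<close>, where the assumption on seed sets
applies. The excess over the main term \<open>A (card X) (card Y)\<close> is additive over these splittings, and each of the two
remainders is a sixteenth of a side, so by induction it contributes a quarter of the permitted excess. The other half is left
for the hit parts and the vertices of low degree.

If the main term is not dominated by the error (\<open>small\<close> fails), the factor \<open>9/8\<close> would be too expensive.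
\<close>

lemma discrepancy_upper_bound:
  fixes r :: "'v set \<Rightarrow> real" and A b B \<sigma> \<Delta> G H :: real
  assumes V: "finite V" and nonneg: "0 \<le> A" "0 \<le> b" "0 < \<sigma>"
    and deg: "\<And>v. v \<in> V \<Longrightarrow> real (card {u \<in> V. {u, v} \<in> J}) \<le> \<Delta>"
    and mean: "\<And>X Y. X \<subseteq> V \<Longrightarrow> Y \<subseteq> V \<Longrightarrow>
                 weight r X Y \<le> A * real (card X) * real (card Y) + b * sqrt (real (card X) * real (card Y))"
    and seed: "\<And>W X Y. W \<subseteq> V \<Longrightarrow> X \<subseteq> V \<inter> nbhd J W \<Longrightarrow> Y \<subseteq> V \<inter> nbhd J W \<Longrightarrow>
                 weight (\<lambda>e. of_bool (e \<in> J \<and> e \<inter> W = {})) X Y \<le> 9/8 * weight r X Y + G * real (card W)"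
    and H: "2 * \<Delta> + G \<le> H * \<sigma>\<^sup>2" "0 \<le> H"
    and B: "3 * b + 8/3 * (32 * H + 2) * \<sigma> \<le> B"
    and X: "X \<subseteq> V" and Y: "Y \<subseteq> V"
    and small: "A * sqrt (real (card X) * real (card Y)) \<le> B"
  shows "weight (\<lambda>e. of_bool (e \<in> J)) X Y
           \<le> A * real (card X) * real (card Y) + B * sqrt (real (card X) * real (card Y))"
  using X Y small
proof (induction "card X + card Y" arbitrary: X Y rule: less_induct)
  case less
  let ?j = "\<lambda>e. of_bool (e \<in> J) :: real"
  have B0: "0 \<le> B"
  proof -
    have "0 \<le> 8/3 * (32 * H + 2) * \<sigma>" using nonneg H(2) by (intro mult_nonneg_nonneg) auto
    then show ?thesis using B nonneg by linarith
  qed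
  have fin: "finite X" "finite Y" using less.prems V by (auto intro: finite_subset[of _ V])
  show ?case
  proof (cases "X = {} \<or> Y = {}")
    case True
    then show ?thesis by auto
  next
    case False
    define p where "p = sqrt (real (card X))"
    define q where "q = sqrt (real (card Y))"
    have pq: "0 < p" "0 < q" using False fin by (auto simp: p_def q_def card_gt_0_iff)
    have p2: "real (card X) = p\<^sup>2" and q2: "real (card Y) = q\<^sup>2" by (auto simp: p_def q_def)
    have S: "sqrt (real (card X) * real (card Y)) = p * q" by (simp add: p_def q_def real_sqrt_mult)
    have sub_sqrt: "sqrt (real a * real b) \<le> c * (p * q)"
      if "real a * real b \<le> (c * (p * q))\<^sup>2" "0 \<le> c" for a b c
      using that pq by (intro real_le_lsqrt) auto
    obtain T Y' R where T: "T \<subseteq> X" "real (card T) * \<sigma> \<le> 16 * (p * q)"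
      and Y': "Y' \<subseteq> Y" "R \<subseteq> Y" "Y' \<inter> R = {}" "\<And>y. y \<in> Y' \<Longrightarrow> \<exists>x\<in>T. {x, y} \<in> J"
      and R: "real (card R) \<le> q\<^sup>2 / 16"
      and wt1: "weight ?j X Y \<le> \<sigma> * (p * q) + weight ?j X Y' + weight ?j X R"
      by (rule hit_part_extraction[OF fin(1) eq_refl[OF p2] fin(2) eq_refl[OF q2] pq nonneg(3), where J = J]) (rule that; (assumption | blast))
    have finY': "finite Y'" "finite R" using Y'(1,2) fin by (auto intro: finite_subset[of _ Y])
    have cY': "card Y' + card R \<le> card Y"
      using card_mono[of Y "Y' \<union> R"] Y' fin finY' by (simp add: card_Un_disjoint)
    then have cY'q: "real (card Y') \<le> q\<^sup>2" using q2 by simp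
    obtain T' X' R' where T': "T' \<subseteq> Y'" "real (card T') * \<sigma> \<le> 16 * (q * p)"
      and X': "X' \<subseteq> X" "R' \<subseteq> X" "X' \<inter> R' = {}" "\<And>x. x \<in> X' \<Longrightarrow> \<exists>y\<in>T'. {y, x} \<in> J"
      and R': "real (card R') \<le> p\<^sup>2 / 16"
      and wt2: "weight ?j Y' X \<le> \<sigma> * (q * p) + weight ?j Y' X' + weight ?j Y' R'"
      by (rule hit_part_extraction[OF finY'(1) cY'q fin(1) eq_refl[OF p2] pq(2,1) nonneg(3), where J = J]) (rule that; (assumption | blast))
    have finX': "finite X'" "finite R'" using X'(1,2) fin by (auto intro: finite_subset[of _ X])
    have cX': "card X' + card R' \<le> card X"
      using card_mono[of X "X' \<union> R'"] X' fin finX' by (simp add: card_Un_disjoint)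
    define W where "W = T \<union> T'"
    have W: "W \<subseteq> V" using T T' Y' less.prems unfolding W_def by auto
    have "real (card W) \<le> real (card T) + real (card T')"
      unfolding W_def using card_Un_le[of T T'] by simp
    then have "real (card W) * \<sigma> \<le> (real (card T) + real (card T')) * \<sigma>"
      using nonneg by (intro mult_right_mono) auto
    then have cW: "real (card W) * \<sigma> \<le> 32 * (p * q)"
      using T(2) T'(2) by (simp add: algebra_simps)
    have X'V: "X' \<subseteq> V" "Y' \<subseteq> V" "R \<subseteq> V" "R' \<subseteq> V" using X' Y' less.prems by auto
    have nb: "X' \<subseteq> V \<inter> nbhd J W" "Y' \<subseteq> V \<inter> nbhd J W"
    proof -
      have "\<exists>w\<in>W. {x, w} \<in> J" if "x \<in> X'" for x
        using X'(4)[OF that] unfolding W_def by (metis UnI2 insert_commute)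
      then show "X' \<subseteq> V \<inter> nbhd J W" using X'V(1) unfolding nbhd_def by blast
      have "\<exists>w\<in>W. {y, w} \<in> J" if "y \<in> Y'" for y
        using Y'(4)[OF that] unfolding W_def by (metis UnI1 insert_commute)
      then show "Y' \<subseteq> V \<inter> nbhd J W" using X'V(2) unfolding nbhd_def by blast
    qed

    \<comment> \<open>The induction hypothesis, in the form that covers both remainders.\<close>
    have rest: "weight ?j X1 Y1 \<le> A * real (card X1) * real (card Y1) + B * (p * q) / 4"
      if sub: "X1 \<subseteq> X" "Y1 \<subseteq> Y" and c: "real (card X1) * real (card Y1) \<le> p\<^sup>2 * q\<^sup>2 / 16" for X1 Y1
    proof -
      have cle: "card X1 \<le> card X" "card Y1 \<le> card Y" using sub fin by (auto intro: card_mono)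
      have "card X1 + card Y1 \<noteq> card X + card Y"
      proof
        assume "card X1 + card Y1 = card X + card Y"
        then have "card X1 = card X" "card Y1 = card Y" using cle by auto
        then show False using c p2 q2 pq by (simp add: zero_less_mult_iff)
      qed
      then have lt: "card X1 + card Y1 < card X + card Y" using cle by linarith
      have sq: "sqrt (real (card X1) * real (card Y1)) \<le> 1/4 * (p * q)"
        using c by (intro sub_sqrt) (auto simp: power_mult_distrib power_divide)
      then have "A * sqrt (real (card X1) * real (card Y1)) \<le> A * (p * q)"
        using nonneg pq by (intro mult_left_mono) (auto intro: order_trans[of _ "1/4 * (p * q)"])
      then have "A * sqrt (real (card X1) * real (card Y1)) \<le> B" using less.prems(3) S by simp
      from less.hyps[OF lt _ _ this] sub less.prems
      have "weight ?j X1 Y1 \<le> A * real (card X1) * real (card Y1) + B * sqrt (real (card X1) * real (card Y1))"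
        by blast
      also have "B * sqrt (real (card X1) * real (card Y1)) \<le> B * (1/4 * (p * q))"
        using sq B0 by (intro mult_left_mono)
      finally show ?thesis by simp
    qed
    have r1: "weight ?j X R \<le> A * real (card X) * real (card R) + B * (p * q) / 4"
      using R p2 pq Y' by (intro rest) (auto simp: field_simps)
    have r2: "weight ?j R' Y' \<le> A * real (card R') * real (card Y') + B * (p * q) / 4"
    proof (intro rest)
      have "real (card R') * real (card Y') \<le> (p\<^sup>2 / 16) * q\<^sup>2"
        using R' cY'q by (intro mult_mono) auto
      then show "real (card R') * real (card Y') \<le> p\<^sup>2 * q\<^sup>2 / 16" by simp
    qed (use X' Y' in auto)

    have c': "real (card X') \<le> p\<^sup>2" "real (card Y') \<le> q\<^sup>2" using cX' cY' p2 q2 by linarith+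
    then have cc: "real (card X') * real (card Y') \<le> p\<^sup>2 * q\<^sup>2" by (intro mult_mono) auto
    have "weight ?j X' Y' \<le> weight (\<lambda>e. of_bool (e \<in> J \<and> e \<inter> W = {})) X' Y' + 2 * \<Delta> * real (card W)"
      by (rule weight_meeting_le[OF V W X'V(1,2) deg])
    also have "weight (\<lambda>e. of_bool (e \<in> J \<and> e \<inter> W = {})) X' Y' \<le> 9/8 * weight r X' Y' + G * real (card W)"
      by (rule seed[OF W nb])
    also have "weight r X' Y' \<le> A * real (card X') * real (card Y') + b * (p * q)"
    proof -
      have "sqrt (real (card X') * real (card Y')) \<le> 1 * (p * q)"
        using cc by (intro sub_sqrt) (auto simp: power_mult_distrib)
      then have "b * sqrt (real (card X') * real (card Y')) \<le> b * (p * q)"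
        using nonneg by (intro mult_left_mono) auto
      then show ?thesis using mean[OF X'V(1,2)] by linarith
    qed
    finally have main: "weight ?j X' Y' \<le> 9/8 * (A * real (card X') * real (card Y') + b * (p * q))
        + (2 * \<Delta> + G) * real (card W)" by (simp add: algebra_simps)
    have GW: "(2 * \<Delta> + G) * real (card W) \<le> 32 * H * \<sigma> * (p * q)"
    proof -
      have "(2 * \<Delta> + G) * real (card W) \<le> (H * \<sigma>\<^sup>2) * real (card W)"
        using H by (intro mult_right_mono) auto
      also have "\<dots> = (H * \<sigma>) * (real (card W) * \<sigma>)" by (simp add: power2_eq_square)
      also have "\<dots> \<le> (H * \<sigma>) * (32 * (p * q))"
        using cW H nonneg by (intro mult_left_mono) auto
      finally show ?thesis by (simp add: algebra_simps)
    qed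
    \<comment> \<open>The surplus of the factor \<open>9/8\<close> over the main term.\<close>
    have extra: "1/8 * (A * real (card X') * real (card Y')) \<le> B * (p * q) / 8"
    proof -
      have "A * (real (card X') * real (card Y')) \<le> A * (p\<^sup>2 * q\<^sup>2)"
        using cc nonneg by (intro mult_left_mono)
      also have "\<dots> = (A * (p * q)) * (p * q)" by (simp add: power2_eq_square)
      also have "\<dots> \<le> B * (p * q)" using less.prems(3) S pq by (intro mult_right_mono) auto
      finally show ?thesis by simp
    qed
    have areas: "A * real (card X) * real (card R) + A * real (card R') * real (card Y')
        + A * real (card X') * real (card Y') \<le> A * real (card X) * real (card Y)"
    proof -
      have "card R' * card Y' + card X' * card Y' \<le> card X * card Y'"
        using cX' by (metis add.commute add_mult_distrib mult_le_mono1)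
      moreover have "card X * card R + card X * card Y' \<le> card X * card Y"
        using cY' by (metis add.commute add_mult_distrib2 mult_le_mono2)
      ultimately have "card X * card R + card R' * card Y' + card X' * card Y' \<le> card X * card Y"
        by linarith
      then have "real (card X) * real (card R) + real (card R') * real (card Y') + real (card X') * real (card Y')
          \<le> real (card X) * real (card Y)"
        by (metis (mono_tags) of_nat_add of_nat_le_iff of_nat_mult)
      from mult_left_mono[OF this nonneg(1)] show ?thesis by (simp add: algebra_simps)
    qed
    have "8/3 * (32 * H + 2) * \<sigma> = 8/3 * ((32 * H + 2) * \<sigma>)" by simp
    then have "9/8 * b + (32 * H + 2) * \<sigma> \<le> 3/8 * B" using B by linarith
    then have Bpq: "(9/8 * b + (32 * H + 2) * \<sigma>) * (p * q) \<le> 3/8 * B * (p * q)"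
      using pq by (intro mult_right_mono) auto
    have "weight ?j X Y' \<le> \<sigma> * (p * q) + weight ?j X' Y' + weight ?j R' Y'"
      using wt2 by (simp only: weight_commute[of ?j Y'] mult.commute[of q p])
    then have "weight ?j X Y \<le> \<sigma> * (p * q) + (\<sigma> * (p * q) + weight ?j X' Y' + weight ?j R' Y') + weight ?j X R"
      using wt1 by linarith
    also have "\<dots> \<le> A * real (card X) * real (card Y) + B * (p * q)"
      using r1 r2 main GW extra areas Bpq by (simp add: algebra_simps)
    finally show ?thesis unfolding S .
  qed
qed

section \<open>Bijumbledness of random subgraphs\<close>

text \<open>
Three bad events are excluded: a vertex of large degree, a seed set with a large excess, and a dense pair
with a large deviation. Outside these events, dense pairs are fine directly. For the other pairs the lower bound is trivial,
because the main term is at most the error, and the upper bound is \<open>discrepancy_upper_bound\<close>.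
\<close>

lemma random_subgraph_bijumbled:
  fixes b D K0 :: real
  assumes V: "finite V" "E \<subseteq> nsets V 2" and n: "2 \<le> card V"
    and r: "\<And>e. e \<in> E \<Longrightarrow> 0 \<le> r e \<and> r e \<le> 1" "\<And>e. e \<notin> E \<Longrightarrow> r e = 0"
    and D: "\<And>v. v \<in> V \<Longrightarrow> (\<Sum>e\<in>{e \<in> E. v \<in> e}. r e) \<le> D"
    and A: "0 \<le> A" "A \<le> 1" "A * real (card V) \<le> D" and b: "0 \<le> b" and K0: "0 \<le> K0"
    and mean: "\<And>X Y. X \<subseteq> V \<Longrightarrow> Y \<subseteq> V \<Longrightarrow>
                 A * real (card X) * real (card Y) - 4 * b * sqrt (real (card X) * real (card Y)) \<le> weight r X Y \<and>
                 weight r X Y \<le> A * real (card X) * real (card Y) + b * sqrt (real (card X) * real (card Y))"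
  defines "L \<equiv> ln (2 * real (card V))"
  shows "measure_pmf.prob (random_edges E r)
           {w. \<not> bijumbled A (5 * b + 5000 * (K0 + 5) * sqrt (D + L)) V {e \<in> E. w e}}
         \<le> (2 * real (card V)) powr (- K0)"
proof -
  \<comment> \<open>One unit is lost in \<open>seed_excess_tail_all\<close> and \<open>random_degree_tail\<close>, the other two absorb the constant factors.\<close>
  define K where "K = K0 + 3"
  have K: "3 \<le> K" using K0 unfolding K_def by simp
  define \<sigma> where "\<sigma> = sqrt (D + L)"
  have L0: "0 < L" using n unfolding L_def by simp
  have D0: "0 \<le> D" using A(1,3) by (smt (verit) mult_nonneg_nonneg of_nat_0_le_iff)
  have \<sigma>: "0 < \<sigma>" "\<sigma>\<^sup>2 = D + L" unfolding \<sigma>_def using L0 D0 by auto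
  have rE: "(\<lambda>e. of_bool (e \<in> E) * r e) = r" using r(2) by (intro ext) (auto simp: of_bool_def)
  have Vne: "V \<noteq> {}" using n by auto
  define M where "M = random_edges E r"
  define J where "J w = {e \<in> E. w e}" for w
  define S where "S X Y = sqrt (real (card X) * real (card Y))" for X Y :: "'a set"
  have S2: "real (card X) * real (card Y) = (S X Y)\<^sup>2" and S0: "0 \<le> S X Y" for X Y :: "'a set"
    unfolding S_def by auto
  define bad1 where "bad1 = {w. \<exists>v\<in>V. 2 * D + K * L < real (card {u \<in> V. {u, v} \<in> J w})}"
  \<comment> \<open>The parameter \<open>1/16\<close> turns the expected number \<open>m\<close> of edges into \<open>(1 + 2/16) m = 9/8 m\<close>.\<close>
  define bad2 where "bad2 = {w. \<exists>W\<in>Pow V - {{}}. \<exists>X Y. X \<subseteq> V \<inter> nbhd (J w) W \<and> Y \<subseteq> V \<inter> nbhd (J w) W \<and>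
                 2 * real (card (V \<inter> nbhd (J w) W)) + K * L * real (card W) < seed_excess E r W (1/16) w X Y}"
  define bad3 where "bad3 = {w. \<exists>X Y. X \<subseteq> V \<and> Y \<subseteq> V \<and> 2 * \<sigma> \<le> A * S X Y \<and>
                 weight r X Y \<le> 2 * A * (real (card X) * real (card Y)) \<and>
                 (6 + K) * \<sigma> * S X Y < \<bar>weight (\<lambda>e. of_bool (e \<in> E \<and> w e)) X Y - weight r X Y\<bar>}"
  have p1: "measure_pmf.prob M bad1 \<le> real (card V) * exp (- (K * L))"
    unfolding M_def bad1_def J_def by (rule random_degree_tail[OF V r(1) D])
  have p2: "measure_pmf.prob M bad2 \<le> exp (- ((K - 1) * L))"
    unfolding M_def bad2_def J_def L_def
    by (rule seed_excess_tail_all[OF V(1) Vne V(2) r(1)]) (use K in auto)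
  have p3: "measure_pmf.prob M bad3 \<le> 2 * exp (- (K * L))"
    unfolding M_def bad3_def S_def
    using dense_pairs_tail[where r = r and K = K and L = L and A = A, OF V r(1) A(1,2) _ \<sigma>(1)]
    unfolding rE using A(3) K L0 D0 \<sigma>(2) by simp

  have good: "bijumbled A (5 * b + 5000 * (K0 + 5) * \<sigma>) V (J w)" if w: "w \<notin> bad1" "w \<notin> bad2" "w \<notin> bad3" for w
  proof -
    define B where "B = 5 * b + 5000 * (K0 + 5) * \<sigma>"
    define \<Delta> where "\<Delta> = 2 * D + K * L"
    have jw: "(\<lambda>e. of_bool (e \<in> J w) :: real) = (\<lambda>e. of_bool (e \<in> E \<and> w e))" unfolding J_def by simp
    have deg: "real (card {u \<in> V. {u, v} \<in> J w}) \<le> \<Delta>" if "v \<in> V" for v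
      using w(1) that unfolding bad1_def \<Delta>_def by force
    have seed: "weight (\<lambda>e. of_bool (e \<in> J w \<and> e \<inter> W = {})) X Y \<le> 9/8 * weight r X Y + (32 * \<Delta> + 16 * K * L) * real (card W)"
      if W: "W \<subseteq> V" and X: "X \<subseteq> V \<inter> nbhd (J w) W" and Y: "Y \<subseteq> V \<inter> nbhd (J w) W" for W X Y
    proof (cases "W = {}")
      case True
      then have "X = {}" using X unfolding nbhd_def by auto
      then show ?thesis using True by simp
    next
      case False
      let ?m = "weight (\<lambda>e. of_bool (e \<in> E \<and> e \<inter> W = {}) * r e) X Y"
      let ?e = "weight (\<lambda>e. of_bool (e \<in> E \<and> w e \<and> e \<inter> W = {})) X Y"
      let ?N = "real (card (V \<inter> nbhd (J w) W))"
      have "W \<in> Pow V - {{}}" using W False by simp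
      then have "seed_excess E r W (1/16) w X Y \<le> 2 * ?N + K * L * real (card W)"
        using w(2) X Y unfolding bad2_def by (metis (mono_tags, lifting) linorder_not_less mem_Collect_eq)
      then have "1/16 * (?e - ?m) - 2 * (1/16)\<^sup>2 * ?m \<le> 2 * ?N + K * L * real (card W)"
        unfolding seed_excess_def .
      then have 1: "?e \<le> 9/8 * ?m + 32 * ?N + 16 * (K * L * real (card W))"
        by (simp add: power2_eq_square algebra_simps)
      have "V \<inter> nbhd (J w) W \<subseteq> (\<Union>v\<in>W. {u \<in> V. {u, v} \<in> J w})" unfolding nbhd_def by auto
      then have "card (V \<inter> nbhd (J w) W) \<le> card (\<Union>v\<in>W. {u \<in> V. {u, v} \<in> J w})"
        using V(1) finite_subset[OF W V(1)] by (intro card_mono) auto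
      also have "\<dots> \<le> (\<Sum>v\<in>W. card {u \<in> V. {u, v} \<in> J w})"
        by (intro card_UN_le finite_subset[OF W V(1)])
      finally have "?N \<le> (\<Sum>v\<in>W. real (card {u \<in> V. {u, v} \<in> J w}))" by (simp flip: of_nat_sum)
      also have "\<dots> \<le> (\<Sum>v\<in>W. \<Delta>)" using deg W by (intro sum_mono) auto
      finally have 2: "?N \<le> \<Delta> * real (card W)" by (simp add: mult.commute)
      have 3: "?m \<le> weight r X Y"
      proof (rule weight_mono)
        show "of_bool (e \<in> E \<and> e \<inter> W = {}) * r e \<le> r e" for e
          using r(1)[of e] r(2)[of e] by (cases "e \<in> E") auto
      qed
      have "?e = weight (\<lambda>e. of_bool (e \<in> J w \<and> e \<inter> W = {})) X Y"
        unfolding J_def by (intro arg_cong[of _ _ "\<lambda>g. weight g X Y"] ext) auto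
      then show ?thesis using 1 2 3 by (simp add: algebra_simps)
    qed
    show ?thesis
      unfolding bijumbled_def B_def[symmetric]
    proof (intro allI impI)
      fix X Y assume XY: "X \<subseteq> V \<and> Y \<subseteq> V"
      then have X: "X \<subseteq> V" and Y: "Y \<subseteq> V" by auto
      have fin: "finite X" "finite Y" using X Y V by (auto intro: finite_subset[of _ V])
      have ep: "real (e_pairs (J w) X Y) = weight (\<lambda>e. of_bool (e \<in> J w)) X Y" by (rule e_pairs_eq_weight[OF fin])
      have area: "A * real (card X) * real (card Y) = A * (S X Y)\<^sup>2" using S2[of X Y] by simp
      show "\<bar>real (e_pairs (J w) X Y) - A * real (card X) * real (card Y)\<bar> \<le> B * sqrt (real (card X) * real (card Y))"
      proof (cases "A * S X Y \<le> B")
        case True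
        have B_eq: "B = 5 * b + 5000 * (K + 2) * \<sigma>" unfolding B_def K_def by simp
        have H: "2 * \<Delta> + (32 * \<Delta> + 16 * K * L) \<le> (68 + 50 * K) * \<sigma>\<^sup>2"
        proof -
          have KD: "0 \<le> K * D" using K D0 by simp
          show ?thesis unfolding \<Delta>_def \<sigma>(2) using D0 L0 KD by (simp add: algebra_simps)
        qed
        have KS: "0 \<le> K * \<sigma>" using K \<sigma> by simp
        have B: "3 * b + 8/3 * (32 * (68 + 50 * K) + 2) * \<sigma> \<le> B"
          unfolding B_eq using b \<sigma>(1) KS by (simp add: algebra_simps)
        have "weight (\<lambda>e. of_bool (e \<in> J w)) X Y
           \<le> A * real (card X) * real (card Y) + B * sqrt (real (card X) * real (card Y))"
          by (rule discrepancy_upper_bound[where r = r and \<Delta> = \<Delta> and G = "32 * \<Delta> + 16 * K * L"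
                and H = "68 + 50 * K", OF V(1) A(1) b \<sigma>(1) deg _ seed H _ B X Y])
            (use mean K True in \<open>auto simp: S_def\<close>)
        moreover have "A * real (card X) * real (card Y) \<le> B * sqrt (real (card X) * real (card Y))"
          using mult_right_mono[OF True S0[of X Y]] unfolding area S_def[symmetric]
          by (simp add: power2_eq_square)
        moreover have "0 \<le> real (e_pairs (J w) X Y)" by simp
        ultimately show ?thesis unfolding ep[symmetric] by linarith
      next
        case False
        have K0\<sigma>: "0 \<le> K0 * \<sigma>" using K0 \<sigma> by simp
        have big: "2 * \<sigma> \<le> A * S X Y" "b \<le> A * S X Y"
          using False b \<sigma>(1) K0\<sigma> unfolding B_def by (auto simp: algebra_simps)
        have "weight r X Y \<le> A * (S X Y)\<^sup>2 + b * S X Y"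
          using mean[OF X Y] unfolding area S_def[symmetric] by simp
        also have "b * S X Y \<le> A * (S X Y)\<^sup>2"
          using mult_right_mono[OF big(2) S0[of X Y]] by (simp add: power2_eq_square)
        finally have ub: "weight r X Y \<le> 2 * A * (real (card X) * real (card Y))" unfolding S2 by simp
        have dev: "\<bar>weight (\<lambda>e. of_bool (e \<in> J w)) X Y - weight r X Y\<bar> \<le> (6 + K) * \<sigma> * S X Y"
        proof (rule ccontr)
          assume "\<not> ?thesis"
          then have "w \<in> bad3"
            using ub X Y big(1) unfolding bad3_def jw not_le by blast
          then show False using w(3) by contradiction
        qed
        have "(6 + K) * \<sigma> \<le> 5000 * (K0 + 5) * \<sigma>"
          using K0\<sigma> \<sigma>(1) unfolding K_def by (simp add: algebra_simps)
        then have "(6 + K) * \<sigma> * S X Y \<le> 5000 * (K0 + 5) * \<sigma> * S X Y"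
          by (rule mult_right_mono) (rule S0)
        moreover have "0 \<le> b * S X Y" using b S0 by simp
        moreover have "B * S X Y = 5 * (b * S X Y) + 5000 * (K0 + 5) * \<sigma> * S X Y"
          unfolding B_def by (simp add: algebra_simps)
        ultimately show ?thesis
          using mean[OF X Y] dev unfolding ep S_def[symmetric] by linarith
      qed
    qed
  qed

  have "measure_pmf.prob M {w. \<not> bijumbled A (5 * b + 5000 * (K0 + 5) * \<sigma>) V (J w)}
      \<le> measure_pmf.prob M (bad1 \<union> (bad2 \<union> bad3))"
    using good by (intro measure_pmf.finite_measure_mono) auto
  also have "\<dots> \<le> measure_pmf.prob M bad1 + measure_pmf.prob M (bad2 \<union> bad3)"
    by (rule measure_Un_le) auto
  also have "measure_pmf.prob M (bad2 \<union> bad3) \<le> measure_pmf.prob M bad2 + measure_pmf.prob M bad3"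
    by (rule measure_Un_le) auto
  finally have "measure_pmf.prob M {w. \<not> bijumbled A (5 * b + 5000 * (K0 + 5) * \<sigma>) V (J w)}
      \<le> real (card V) * exp (- (K * L)) + (exp (- ((K - 1) * L)) + 2 * exp (- (K * L)))"
    using p1 p2 p3 by linarith
  also have "\<dots> \<le> (2 * real (card V)) powr (- K0)"
  proof -
    define q where "q = exp (- L)"
    have q: "q = 1 / (2 * real (card V))" unfolding q_def L_def using n by (simp add: exp_minus inverse_eq_divide)
    have q0: "0 < q" "q \<le> 1/4" unfolding q using n by (auto simp: field_simps)
    have pw: "(2 * real (card V)) powr (- K0) = exp (- (K0 * L))"
      using n unfolding L_def by (simp add: powr_def)
    have k: "exp (- (K * L)) = exp (- (K0 * L)) * q ^ 3" "exp (- ((K - 1) * L)) = exp (- (K0 * L)) * q\<^sup>2"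
      unfolding K_def q_def by (simp_all add: algebra_simps flip: exp_add exp_of_nat_mult)
    have "real (card V) * q ^ 3 + (q\<^sup>2 + 2 * q ^ 3) \<le> 1"
    proof -
      have "real (card V) * q = 1/2" unfolding q using n by simp
      then have "real (card V) * q ^ 3 = 1/2 * q\<^sup>2" by (simp add: power3_eq_cube power2_eq_square)
      moreover have "q\<^sup>2 \<le> 1/16" using power_mono[of q "1/4" 2] q0 by (simp add: power_divide)
      moreover have "q ^ 3 \<le> 1/64" using power_mono[of q "1/4" 3] q0 by (simp add: power_divide)
      ultimately show ?thesis by linarith
    qed
    then have "exp (- (K0 * L)) * (real (card V) * q ^ 3 + (q\<^sup>2 + 2 * q ^ 3)) \<le> exp (- (K0 * L)) * 1"
      by (intro mult_left_mono) auto
    then show ?thesis unfolding pw k by (simp add: algebra_simps)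
  qed
  finally show ?thesis unfolding M_def J_def \<sigma>_def .
qed

section \<open>Edge weights with bounded degrees\<close>

text \<open>
Every vertex of \<open>V\<close> sends \<open>k\<close> units to its neighbours, at most one unit along each edge in each direction. The condition
\<open>f (v, w) = 0\<close> away from the edges makes this set compact in the product topology.
\<close>

definition unit_flows :: "'v set \<Rightarrow> 'v set set \<Rightarrow> real \<Rightarrow> ('v \<times> 'v \<Rightarrow> real) set" where
  "unit_flows V E k =
     {f. (\<forall>v w. (if v \<in> V \<and> w \<in> V \<and> {v, w} \<in> E then 0 \<le> f (v, w) \<and> f (v, w) \<le> 1 else f (v, w) = 0)) \<and>
         (\<forall>v\<in>V. (\<Sum>w\<in>V. f (v, w)) = k)}"

lemma unit_flows_bounds:
  assumes "f \<in> unit_flows V E k"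
  shows "0 \<le> f (v, w)" "f (v, w) \<le> of_bool ({v, w} \<in> E)"
proof -
  have "if v \<in> V \<and> w \<in> V \<and> {v, w} \<in> E then 0 \<le> f (v, w) \<and> f (v, w) \<le> 1 else f (v, w) = 0"
    using assms unfolding unit_flows_def by blast
  then show "0 \<le> f (v, w)" "f (v, w) \<le> of_bool ({v, w} \<in> E)" by (auto split: if_splits)
qed

lemma unit_flows_sum: "f \<in> unit_flows V E k \<Longrightarrow> v \<in> V \<Longrightarrow> (\<Sum>w\<in>V. f (v, w)) = k"
  unfolding unit_flows_def by blast

lemma compact_unit_flows: "compact (unit_flows V E k)"
proof -
  define I where "I = (\<lambda>(v, w). if v \<in> V \<and> w \<in> V \<and> {v, w} \<in> E then {0..1} else {0 :: real})"
  have "compactin (product_topology (\<lambda>_. euclidean) UNIV) (PiE UNIV I)"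
    unfolding compactin_PiE by (auto simp: I_def)
  then have box: "compact (PiE UNIV I)" by (simp add: euclidean_product_topology)
  have cont: "continuous_on UNIV (\<lambda>f :: 'a \<times> 'a \<Rightarrow> real. \<Sum>w\<in>V. f (v, w))" for v
    by (intro continuous_on_sum continuous_on_product_coordinates)
  have closed: "closed (\<Inter>v\<in>V. {f :: 'a \<times> 'a \<Rightarrow> real. (\<Sum>w\<in>V. f (v, w)) = k})"
    by (intro closed_INT ballI closed_Collect_eq cont continuous_on_const)
  have "unit_flows V E k = PiE UNIV I \<inter> (\<Inter>v\<in>V. {f. (\<Sum>w\<in>V. f (v, w)) = k})"
    unfolding unit_flows_def I_def PiE_UNIV_domain by (auto simp: Pi_iff split: if_splits)
  then show ?thesis using compact_Int_closed[OF box closed] by simp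
qed

text \<open>
Minimise the sum of the squared loads \<open>\<Sum>u\<in>V. f (u, w)\<close>; the minimum exists by compactness. If \<open>v\<close> sends something to
\<open>w\<close> and could send more to a less loaded neighbour \<open>w'\<close>, then diverting a little from \<open>w\<close> to \<open>w'\<close> would lower the sum.
\<close>

lemma least_squares_unit_flow:
  assumes V: "finite V" and deg: "\<And>v. v \<in> V \<Longrightarrow> k \<le> real (card {u \<in> V. {v, u} \<in> E})" and k: "0 \<le> k"
  obtains f where "f \<in> unit_flows V E k"
    "\<And>v w w'. v \<in> V \<Longrightarrow> w \<in> V \<Longrightarrow> w' \<in> V \<Longrightarrow> 0 < f (v, w) \<Longrightarrow> {v, w'} \<in> E \<Longrightarrow>
       (\<Sum>u\<in>V. f (u, w')) < (\<Sum>u\<in>V. f (u, w)) \<Longrightarrow> f (v, w') = 1"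
proof -
  let ?F = "unit_flows V E k"
  let ?\<Phi> = "\<lambda>f :: 'a \<times> 'a \<Rightarrow> real. \<Sum>w\<in>V. (\<Sum>v\<in>V. f (v, w))\<^sup>2"
  define f0 where "f0 = (\<lambda>(v, w). if v \<in> V \<and> w \<in> V \<and> {v, w} \<in> E then k / real (card {u \<in> V. {v, u} \<in> E}) else 0)"
  \<comment> \<open>Sending equal amounts to all neighbours is admissible.\<close>
  have "f0 \<in> ?F"
    unfolding unit_flows_def
  proof (intro CollectI conjI allI ballI)
    fix v w
    show "if v \<in> V \<and> w \<in> V \<and> {v, w} \<in> E then 0 \<le> f0 (v, w) \<and> f0 (v, w) \<le> 1 else f0 (v, w) = 0"
    proof (cases "v \<in> V \<and> w \<in> V \<and> {v, w} \<in> E")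
      case True
      then have "w \<in> {u \<in> V. {v, u} \<in> E}" by simp
      moreover have "finite {u \<in> V. {v, u} \<in> E}" using V by simp
      ultimately have "0 < card {u \<in> V. {v, u} \<in> E}" by (metis card_gt_0_iff empty_iff)
      then show ?thesis using True deg[of v] k by (simp add: f0_def)
    qed (auto simp: f0_def)
  next
    fix v assume v: "v \<in> V"
    let ?N = "{u \<in> V. {v, u} \<in> E}"
    have "(\<Sum>w\<in>V. f0 (v, w)) = (\<Sum>w\<in>?N. k / real (card ?N))"
      unfolding sum.inter_filter[OF V] by (intro sum.cong) (auto simp: f0_def v)
    also have "\<dots> = k"
    proof (cases "card ?N = 0")
      case True
      then show ?thesis using deg[OF v] k by simp
    qed simp
    finally show "(\<Sum>w\<in>V. f0 (v, w)) = k" .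
  qed
  then have ne: "?F \<noteq> {}" by blast
  have cont: "continuous_on ?F ?\<Phi>"
    by (intro continuous_on_sum continuous_on_power continuous_on_subset[OF continuous_on_product_coordinates]) auto
  obtain f where f: "f \<in> ?F" and f_min: "\<And>g. g \<in> ?F \<Longrightarrow> ?\<Phi> f \<le> ?\<Phi> g"
    using continuous_attains_inf[OF compact_unit_flows ne cont] by blast
  have f01: "v \<in> V \<Longrightarrow> w \<in> V \<Longrightarrow> {v, w} \<in> E \<Longrightarrow> 0 \<le> f (v, w) \<and> f (v, w) \<le> 1" for v w
    using unit_flows_bounds[OF f, of v w] by simp
  have fE: "0 < f (v, w) \<Longrightarrow> {v, w} \<in> E" for v w
    using unit_flows_bounds(2)[OF f, of v w] by (cases "{v, w} \<in> E") auto
  have fk: "v \<in> V \<Longrightarrow> (\<Sum>w\<in>V. f (v, w)) = k" for v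
    by (rule unit_flows_sum[OF f])
  have "f (v, w') = 1"
    if v: "v \<in> V" and w: "w \<in> V" and w': "w' \<in> V" and pos: "0 < f (v, w)" and E': "{v, w'} \<in> E"
      and less: "(\<Sum>u\<in>V. f (u, w')) < (\<Sum>u\<in>V. f (u, w))" for v w w'
  proof (rule ccontr)
    assume "f (v, w') \<noteq> 1"
    then have lt1: "f (v, w') < 1" using f01[OF v w' E'] by linarith
    define L where "L z = (\<Sum>u\<in>V. f (u, z))" for z
    have ww': "w \<noteq> w'" using less by auto
    \<comment> \<open>The first two bounds keep the new flow admissible, the third one makes the linear gain beat the quadratic loss.\<close>
    define \<epsilon> where "\<epsilon> = min (f (v, w)) (min (1 - f (v, w')) ((L w - L w') / 2))"
    have \<epsilon>: "0 < \<epsilon>" "\<epsilon> \<le> f (v, w)" "\<epsilon> \<le> 1 - f (v, w')" "2 * \<epsilon> \<le> L w - L w'"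
    proof -
      have "\<epsilon> \<le> (L w - L w') / 2" unfolding \<epsilon>_def by (intro min.coboundedI2 order_refl)
      then show "2 * \<epsilon> \<le> L w - L w'" by (simp add: pos_le_divide_eq mult.commute)
    qed (use pos lt1 less in \<open>auto simp: \<epsilon>_def L_def\<close>)
    define \<delta> where "\<delta> z = (if z = w' then \<epsilon> else 0) - (if z = w then \<epsilon> else 0)" for z
    define g where "g = (\<lambda>(x, z). f (x, z) + (if x = v then \<delta> z else 0))"
    have sum_\<delta>: "(\<Sum>z\<in>V. h z * \<delta> z) = \<epsilon> * (h w' - h w)" for h
      unfolding \<delta>_def right_diff_distrib sum_subtractf using V w w'
      by (simp add: if_distrib[of "\<lambda>x. _ * x"] mult.commute cong: if_cong)
    have "g \<in> ?F"
      unfolding unit_flows_def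
    proof (intro CollectI conjI allI ballI)
      fix x z
      show "if x \<in> V \<and> z \<in> V \<and> {x, z} \<in> E then 0 \<le> g (x, z) \<and> g (x, z) \<le> 1 else g (x, z) = 0"
      proof (cases "x = v \<and> (z = w \<or> z = w')")
        case True
        then show ?thesis
          using v w w' E' fE[OF pos] f01[OF v w] f01[OF v w'] \<epsilon> ww' by (auto simp: g_def \<delta>_def)
      next
        case False
        then have "g (x, z) = f (x, z)" by (auto simp: g_def \<delta>_def)
        then show ?thesis using f unfolding unit_flows_def by auto
      qed
    next
      fix x assume x: "x \<in> V"
      have "(\<Sum>z\<in>V. g (x, z)) = (\<Sum>z\<in>V. f (x, z)) + (if x = v then (\<Sum>z\<in>V. 1 * \<delta> z) else 0)"
        by (simp add: g_def sum.distrib)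
      also have "\<dots> = k" unfolding sum_\<delta> using fk[OF x] by simp
      finally show "(\<Sum>z\<in>V. g (x, z)) = k" .
    qed
    moreover have Lg: "(\<Sum>u\<in>V. g (u, z)) = L z + \<delta> z" for z
      using V v by (simp add: g_def sum.distrib L_def)
    have "?\<Phi> g = (\<Sum>z\<in>V. (L z)\<^sup>2) + (\<Sum>z\<in>V. (2 * L z + \<delta> z) * \<delta> z)"
      unfolding Lg by (simp add: power2_sum power2_eq_square algebra_simps sum.distrib)
    then have "?\<Phi> g = ?\<Phi> f + \<epsilon> * ((2 * L w' + \<delta> w') - (2 * L w + \<delta> w))"
      unfolding sum_\<delta> L_def .
    moreover have "(2 * L w' + \<delta> w') - (2 * L w + \<delta> w) < 0"
      using \<epsilon> ww' unfolding \<delta>_def by simp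
    then have "\<epsilon> * ((2 * L w' + \<delta> w') - (2 * L w + \<delta> w)) < 0" using \<epsilon>(1) by (simp add: mult_pos_neg)
    ultimately show False using f_min[of g] by linarith
  qed
  then show ?thesis using that[OF f] by blast
qed

text \<open>
Let \<open>W\<close> be the set of vertices of maximal load \<open>t\<close> in a least squares flow and \<open>B\<close> the set of vertices that send
something to \<open>W\<close>. A vertex of \<open>B\<close> saturates its edges that leave \<open>W\<close>, and it has at least \<open>\<alpha> d\<close> edges but sends only
\<open>\<alpha> d / 2\<close> units, so at least \<open>\<alpha> d / 2\<close> of its capacity into \<open>W\<close> is idle. Thus \<open>t (card W)\<close> is at most the number of edges
between \<open>B\<close> and \<open>W\<close> minus \<open>(\<alpha> d / 2) (card B)\<close>, and bijumbledness bounds this by a multiple of \<open>d (card W)\<close>.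
\<close>

lemma balanced_unit_flow:
  fixes p \<beta> a d \<alpha> :: real
  assumes V: "finite V" "V \<noteq> {}" and jumbled: "bijumbled p \<beta> V E"
    and p: "0 \<le> p" "d = p * real (card V)" "0 < d" and \<alpha>: "0 < \<alpha>" and \<beta>: "\<beta> \<le> a * d" "0 \<le> \<beta>" 
    and deg: "\<And>v. v \<in> V \<Longrightarrow> \<alpha> * d \<le> real (card {u \<in> V. {v, u} \<in> E})"
  obtains f where "f \<in> unit_flows V E (\<alpha> * d / 2)"
    "\<And>w. w \<in> V \<Longrightarrow> (\<Sum>v\<in>V. f (v, w)) \<le> (1 + a\<^sup>2 / (2 * \<alpha>)) * d"
proof -
  have \<alpha>d: "0 < \<alpha> * d" using \<alpha> p by simp
  have deg2: "\<alpha> * d / 2 \<le> real (card {u \<in> V. {v, u} \<in> E})" if "v \<in> V" for v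
    using deg[OF that] \<alpha>d by linarith
  have k0: "0 \<le> \<alpha> * d / 2" using \<alpha>d by simp
  obtain f where f: "f \<in> unit_flows V E (\<alpha> * d / 2)"
    and sat: "\<And>v w w'. v \<in> V \<Longrightarrow> w \<in> V \<Longrightarrow> w' \<in> V \<Longrightarrow> 0 < f (v, w) \<Longrightarrow> {v, w'} \<in> E \<Longrightarrow>
       (\<Sum>u\<in>V. f (u, w')) < (\<Sum>u\<in>V. f (u, w)) \<Longrightarrow> f (v, w') = 1"
    using least_squares_unit_flow[OF V(1) deg2 k0] by blast
  have f_le: "f (v, w) \<le> of_bool ({v, w} \<in> E)" and f_ge: "0 \<le> f (v, w)" for v w
    using unit_flows_bounds[OF f, of v w] by auto
  have f_out: "{v, w} \<notin> E \<Longrightarrow> f (v, w) = 0" for v w using f_le[of v w] f_ge[of v w] by simp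
  have fk: "v \<in> V \<Longrightarrow> (\<Sum>w\<in>V. f (v, w)) = \<alpha> * d / 2" for v
    by (rule unit_flows_sum[OF f])
  define L where "L w = (\<Sum>v\<in>V. f (v, w))" for w
  define t where "t = Max (L ` V)"
  define W where "W = {w \<in> V. L w = t}"
  have t_max: "L w \<le> t" if "w \<in> V" for w unfolding t_def using V that by simp
  have W: "W \<subseteq> V" "finite W" using V unfolding W_def by auto
  have "t \<in> L ` V" unfolding t_def using V by (intro Max_in) auto
  then have "W \<noteq> {}" unfolding W_def by auto
  then have W0: "0 < real (card W)" using W by (simp add: card_gt_0_iff)
  define B where "B = {v \<in> V. \<exists>w\<in>W. 0 < f (v, w)}"
  have B: "B \<subseteq> V" "finite B" using V unfolding B_def by auto
  have out: "(\<Sum>w\<in>W. f (v, w)) \<le> (\<Sum>w\<in>W. of_bool ({v, w} \<in> E)) - \<alpha> * d / 2" if v: "v \<in> B" for v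
  proof -
    obtain w where w: "w \<in> W" "0 < f (v, w)" using v unfolding B_def by blast
    have vV: "v \<in> V" using v unfolding B_def by simp
    have eq1: "f (v, w') = of_bool ({v, w'} \<in> E)" if w': "w' \<in> V - W" for w'
    proof (cases "{v, w'} \<in> E")
      case True
      have "L w' < L w" using w w' t_max[of w'] unfolding W_def by force
      then show ?thesis using sat[OF vV _ _ w(2) True] w w' W True unfolding L_def by auto
    qed (use f_out in auto)
    have split: "(\<Sum>w\<in>V. h w) = (\<Sum>w\<in>W. h w) + (\<Sum>w\<in>V - W. h w)" for h :: "'a \<Rightarrow> real"
      using sum.subset_diff[OF W(1) V(1), of h] by simp
    have "(\<Sum>w\<in>V. of_bool ({v, w} \<in> E)) = real (card {u \<in> V. {v, u} \<in> E})"
      using V by (simp add: of_bool_def sum.If_cases Int_def)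
    then have "\<alpha> * d \<le> (\<Sum>w\<in>W. of_bool ({v, w} \<in> E)) + (\<Sum>w\<in>V - W. of_bool ({v, w} \<in> E))"
      using deg[OF vV] split[of "\<lambda>w. of_bool ({v, w} \<in> E)"] by linarith
    moreover have "(\<Sum>w\<in>W. f (v, w)) + (\<Sum>w\<in>V - W. of_bool ({v, w} \<in> E)) = \<alpha> * d / 2"
      using fk[OF vV] split[of "\<lambda>w. f (v, w)"] eq1 by simp
    ultimately show ?thesis by linarith
  qed
  have "t * real (card W) = (\<Sum>w\<in>W. L w)" unfolding W_def by simp
  also have "\<dots> = (\<Sum>v\<in>V. \<Sum>w\<in>W. f (v, w))" unfolding L_def by (rule sum.swap)
  also have "\<dots> = (\<Sum>v\<in>B. \<Sum>w\<in>W. f (v, w))"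
  proof (rule sum.mono_neutral_right[OF V(1) B(1)], intro ballI sum.neutral)
    fix v w assume "v \<in> V - B" "w \<in> W"
    then show "f (v, w) = 0" using f_ge[of v w] unfolding B_def by force
  qed
  also have "\<dots> \<le> (\<Sum>v\<in>B. (\<Sum>w\<in>W. of_bool ({v, w} \<in> E)) - \<alpha> * d / 2)" by (intro sum_mono out)
  also have "\<dots> = weight (\<lambda>e. of_bool (e \<in> E)) B W - \<alpha> * d / 2 * real (card B)"
    unfolding weight_def by (simp add: sum_subtractf)
  also have "weight (\<lambda>e. of_bool (e \<in> E)) B W \<le> p * real (card B) * real (card W) + \<beta> * sqrt (real (card B) * real (card W))"
    using bijumbled_weight[OF jumbled V(1) B(1) W(1)] by linarith
  also have "p * real (card B) * real (card W) \<le> d * real (card W)"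
  proof -
    have "card B \<le> card V" using B V by (simp add: card_mono)
    then have "p * real (card B) \<le> d" unfolding p(2) using p(1) by (intro mult_left_mono) auto
    then show ?thesis by (rule mult_right_mono) simp
  qed
  also have "\<beta> * sqrt (real (card B) * real (card W)) \<le> d * (\<alpha> / 2 * real (card B) + a\<^sup>2 / (2 * \<alpha>) * real (card W))"
  proof -
    define x where "x = sqrt (real (card B))"
    define y where "y = sqrt (real (card W))"
    have xy: "real (card B) = x\<^sup>2" "real (card W) = y\<^sup>2" "sqrt (real (card B) * real (card W)) = x * y" "0 \<le> x * y"
      unfolding x_def y_def by (auto simp: real_sqrt_mult)
    \<comment> \<open>The inequality of the means, weighted so that the terms in \<open>card B\<close> cancel.\<close>
    have "0 \<le> (\<alpha> * x - a * y)\<^sup>2" by simp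
    then have "2 * \<alpha> * (a * (x * y)) \<le> \<alpha>\<^sup>2 * x\<^sup>2 + a\<^sup>2 * y\<^sup>2"
      by (simp add: power2_diff power_mult_distrib algebra_simps)
    then have "a * (x * y) \<le> (\<alpha>\<^sup>2 * x\<^sup>2 + a\<^sup>2 * y\<^sup>2) / (2 * \<alpha>)"
      using \<alpha> by (simp add: field_simps)
    also have "\<dots> = \<alpha> / 2 * x\<^sup>2 + a\<^sup>2 / (2 * \<alpha>) * y\<^sup>2"
      using \<alpha> by (simp add: field_simps power2_eq_square)
    finally have "d * (a * (x * y)) \<le> d * (\<alpha> / 2 * x\<^sup>2 + a\<^sup>2 / (2 * \<alpha>) * y\<^sup>2)"
      using p by (intro mult_left_mono) auto
    moreover have "\<beta> * (x * y) \<le> a * d * (x * y)" using \<beta>(1) xy(4) by (rule mult_right_mono)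
    ultimately show ?thesis unfolding xy(3) unfolding xy(1,2) by (simp only: mult_ac)
  qed
  finally have "t * real (card W) \<le> (1 + a\<^sup>2 / (2 * \<alpha>)) * d * real (card W)"
    by (simp add: algebra_simps)
  then have "t \<le> (1 + a\<^sup>2 / (2 * \<alpha>)) * d" using W0 by simp
  then have "\<And>w. w \<in> V \<Longrightarrow> (\<Sum>v\<in>V. f (v, w)) \<le> (1 + a\<^sup>2 / (2 * \<alpha>)) * d"
    using t_max unfolding L_def by force
  then show ?thesis using that[OF f] by blast
qed

text \<open>
Keep the weight 1 on edges between vertices of degree at most \<open>3 d\<close>, and on every other edge take the larger of the flows
in its two directions, where the flow is a balanced one. The flow out of a vertex guarantees the lower bound on the degree,
the bounded load gives the upper bound. By bijumbledness the set \<open>H\<close> of vertices of larger degree satisfies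
\<open>2 d sqrt (card H) \<le> \<beta> sqrt n\<close>, so each of the two kinds of edges at \<open>H\<close> accounts for at most \<open>3/2 \<beta>\<close> times the square
root of the area.
\<close>

lemma bounded_degree_weighting:
  fixes p \<beta> a d \<alpha> :: real
  assumes V: "finite V" "V \<noteq> {}" "E \<subseteq> nsets V 2" and jumbled: "bijumbled p \<beta> V E"
    and p: "0 \<le> p" "d = p * real (card V)" "0 < d" and \<alpha>: "0 < \<alpha>" and \<beta>: "\<beta> \<le> a * d" "0 \<le> \<beta>"
    and deg: "\<And>v. v \<in> V \<Longrightarrow> \<alpha> * d \<le> real (degree E v)"
  obtains q where "\<And>e. e \<in> E \<Longrightarrow> 0 \<le> q e \<and> q e \<le> 1" "\<And>e. e \<notin> E \<Longrightarrow> q e = 0"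
    "\<And>v. v \<in> V \<Longrightarrow> \<alpha> * d / 2 \<le> (\<Sum>e\<in>{e \<in> E. v \<in> e}. q e)"
    "\<And>v. v \<in> V \<Longrightarrow> (\<Sum>e\<in>{e \<in> E. v \<in> e}. q e) \<le> (3 + a\<^sup>2 / \<alpha> + \<alpha>) * d"
    "\<And>X Y. X \<subseteq> V \<Longrightarrow> Y \<subseteq> V \<Longrightarrow>
       p * real (card X) * real (card Y) - 4 * \<beta> * sqrt (real (card X) * real (card Y)) \<le> weight q X Y \<and>
       weight q X Y \<le> p * real (card X) * real (card Y) + \<beta> * sqrt (real (card X) * real (card Y))"
proof -
  have deg_eq: "degree E v = card {u \<in> V. {u, v} \<in> E}" if "v \<in> V" for v
    unfolding degree_def by (rule card_neighbours_eq[OF V(3) that, symmetric])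
  have "\<alpha> * d \<le> real (card {u \<in> V. {v, u} \<in> E})" if "v \<in> V" for v
    using deg[OF that] deg_eq[OF that] by (simp add: insert_commute)
  then obtain f where f: "f \<in> unit_flows V E (\<alpha> * d / 2)"
    and load: "\<And>w. w \<in> V \<Longrightarrow> (\<Sum>v\<in>V. f (v, w)) \<le> (1 + a\<^sup>2 / (2 * \<alpha>)) * d"
    using balanced_unit_flow[OF V(1,2) jumbled p \<alpha> \<beta>] by blast
  have f01: "0 \<le> f (v, w)" "f (v, w) \<le> 1" for v w
    using unit_flows_bounds[OF f, of v w] order_trans[OF _ of_bool_less_eq_one] by blast+
  have f_out: "{v, w} \<notin> E \<Longrightarrow> f (v, w) = 0" for v w
    using unit_flows_bounds[OF f, of v w] by simp
  have fk: "v \<in> V \<Longrightarrow> (\<Sum>w\<in>V. f (v, w)) = \<alpha> * d / 2" for v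
    by (rule unit_flows_sum[OF f])
  define H where "H = {v \<in> V. 3 * d < real (degree E v)}"
  \<comment> \<open>The larger of the flows in the two directions of an edge.\<close>
  define h where "h e = Max (f ` {(v, w). {v, w} = e})" for e
  have h_eq: "h {v, w} = max (f (v, w)) (f (w, v))" for v w
  proof -
    have "{(v', w'). {v', w'} = {v, w}} = {(v, w), (w, v)}" by (auto simp: doubleton_eq_iff)
    then show ?thesis unfolding h_def by simp
  qed
  define q where "q e = (if e \<in> E then if e \<inter> H = {} then 1 else h e else 0)" for e
  have pair: "\<exists>v w. e = {v, w}" if "e \<in> E" for e using V(3) that by (meson nsets2_E subsetD)
  have q01: "0 \<le> q e" "q e \<le> of_bool (e \<in> E)" for e
    using pair[of e] f01 unfolding q_def by (auto simp: h_eq le_max_iff_disj)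
  have q_sum: "(\<Sum>e\<in>{e \<in> E. v \<in> e}. q e) = (\<Sum>u\<in>{u \<in> V. {u, v} \<in> E}. q {u, v})" if "v \<in> V" for v
    using sum.reindex_bij_betw[OF bij_betw_incident_edges[OF V(3) that], of q] by simp
  have sumN: "(\<Sum>u\<in>{u \<in> V. {u, v} \<in> E}. f (v, u)) = \<alpha> * d / 2" if "v \<in> V" for v
  proof -
    have "(\<Sum>u\<in>{u \<in> V. {u, v} \<in> E}. f (v, u)) = (\<Sum>u\<in>V. f (v, u))"
      using V(1) f_out by (intro sum.mono_neutral_left) (auto simp: insert_commute)
    then show ?thesis using fk[OF that] by simp
  qed
  have low: "\<alpha> * d / 2 \<le> (\<Sum>e\<in>{e \<in> E. v \<in> e}. q e)" if v: "v \<in> V" for v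
  proof -
    have "(\<Sum>u\<in>{u \<in> V. {u, v} \<in> E}. f (v, u)) \<le> (\<Sum>u\<in>{u \<in> V. {u, v} \<in> E}. q {u, v})"
      using f01 by (intro sum_mono) (auto simp: q_def h_eq)
    then show ?thesis using q_sum[OF v] sumN[OF v] by simp
  qed
  have up: "(\<Sum>e\<in>{e \<in> E. v \<in> e}. q e) \<le> (3 + a\<^sup>2 / \<alpha> + \<alpha>) * d" if v: "v \<in> V" for v
  proof -
    define x where "x = a\<^sup>2 / \<alpha> * d"
    have nn: "0 \<le> x" "0 \<le> \<alpha> * d" unfolding x_def using \<alpha> p by auto
    have bound_eq: "(3 + a\<^sup>2 / \<alpha> + \<alpha>) * d = 3 * d + x + \<alpha> * d"
      unfolding x_def by (simp only: distrib_right)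
    show ?thesis
    proof (cases "v \<in> H")
      case True
      have "(\<Sum>u\<in>{u \<in> V. {u, v} \<in> E}. q {u, v}) \<le> (\<Sum>u\<in>{u \<in> V. {u, v} \<in> E}. f (u, v) + f (v, u))"
        using f01 True by (intro sum_mono) (auto simp: q_def h_eq)
      also have "\<dots> = (\<Sum>u\<in>{u \<in> V. {u, v} \<in> E}. f (u, v)) + \<alpha> * d / 2"
        unfolding sum.distrib sumN[OF v] ..
      also have "(\<Sum>u\<in>{u \<in> V. {u, v} \<in> E}. f (u, v)) \<le> (\<Sum>u\<in>V. f (u, v))"
        using V(1) f01 by (intro sum_mono2) auto
      also have "\<dots> \<le> (1 + a\<^sup>2 / (2 * \<alpha>)) * d" by (rule load[OF v])
      finally have "(\<Sum>e\<in>{e \<in> E. v \<in> e}. q e) \<le> (1 + a\<^sup>2 / (2 * \<alpha>)) * d + \<alpha> * d / 2"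
        using q_sum[OF v] by simp
      then have "(\<Sum>e\<in>{e \<in> E. v \<in> e}. q e) \<le> d + x / 2 + \<alpha> * d / 2"
        unfolding x_def using \<alpha> by (simp add: field_simps)
      then show ?thesis unfolding bound_eq using nn p(3) by linarith
    next
      case False
      have "(\<Sum>u\<in>{u \<in> V. {u, v} \<in> E}. q {u, v}) \<le> (\<Sum>u\<in>{u \<in> V. {u, v} \<in> E}. 1)"
        by (intro sum_mono order_trans[OF q01(2) of_bool_less_eq_one])
      also have "\<dots> = real (degree E v)" using deg_eq[OF v] by simp
      also have "\<dots> \<le> 3 * d" using False v unfolding H_def by simp
      finally show ?thesis unfolding bound_eq using q_sum[OF v] nn by linarith
    qed
  qed
  have n0: "0 < real (card V)" using V by (simp add: card_gt_0_iff)
  have Hsmall: "p * (sqrt (real (card H)) * sqrt (real (card V))) \<le> \<beta> / 2"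
  proof (cases "H = {}")
    case True
    then show ?thesis using \<beta> by simp
  next
    case False
    have H: "H \<subseteq> V" "finite H" using V unfolding H_def by auto
    define y where "y = sqrt (real (card H))"
    define z where "z = sqrt (real (card V))"
    have yz: "0 < y" "0 < z" "real (card H) = y\<^sup>2" "real (card V) = z\<^sup>2"
      unfolding y_def z_def using False H n0 by (auto simp: card_gt_0_iff)
    have "3 * d * real (card H) = (\<Sum>v\<in>H. 3 * d)" by simp
    also have "\<dots> \<le> (\<Sum>v\<in>H. \<Sum>u\<in>V. of_bool ({v, u} \<in> E))"
    proof (intro sum_mono)
      fix v assume v: "v \<in> H"
      then have "3 * d \<le> real (card {u \<in> V. {u, v} \<in> E})" using deg_eq[of v] unfolding H_def by auto
      also have "\<dots> = (\<Sum>u\<in>V. of_bool ({v, u} \<in> E))"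
        using V(1) by (simp add: of_bool_def sum.If_cases Int_def insert_commute)
      finally show "3 * d \<le> (\<Sum>u\<in>V. of_bool ({v, u} \<in> E))" .
    qed
    also have "\<dots> = weight (\<lambda>e. of_bool (e \<in> E)) H V" unfolding weight_def ..
    also have "\<dots> \<le> p * real (card H) * real (card V) + \<beta> * sqrt (real (card H) * real (card V))"
      using bijumbled_weight[OF jumbled V(1) H(1) order_refl] by linarith
    finally have "3 * d * y\<^sup>2 \<le> d * y\<^sup>2 + \<beta> * (y * z)"
      unfolding p(2) y_def z_def by (simp add: real_sqrt_mult mult_ac)
    then have "(2 * d * y) * y \<le> (\<beta> * z) * y" by (simp add: power2_eq_square algebra_simps)
    then have "2 * d * y \<le> \<beta> * z" using yz by simp
    then have "2 * (p * (y * z)) * z \<le> \<beta> * z" unfolding p(2) yz(4) by (simp add: power2_eq_square algebra_simps)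
    then have "2 * (p * (y * z)) \<le> \<beta>" using yz by simp
    then show ?thesis unfolding y_def z_def by simp
  qed
  have edges_at_H: "weight (\<lambda>e. of_bool (e \<in> E)) X (Y \<inter> H) \<le> 3/2 * \<beta> * sqrt (real (card X) * real (card Y))"
    if X: "X \<subseteq> V" and Y: "Y \<subseteq> V" for X Y
  proof -
    have fin: "finite X" "finite Y" "finite H" using V X Y by (auto simp: H_def intro: finite_subset[of _ V])
    define x where "x = sqrt (real (card X))"
    define y where "y = sqrt (real (card Y))"
    define u where "u = sqrt (real (card (Y \<inter> H)))"
    have sq: "real (card X) = x * x" "real (card (Y \<inter> H)) = u * u" "0 \<le> x" "0 \<le> y" "0 \<le> u"
      unfolding x_def y_def u_def by auto
    have uy: "u \<le> y" "u \<le> sqrt (real (card H))" unfolding u_def y_def using fin by (auto intro!: card_mono)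
    have xn: "x \<le> sqrt (real (card V))" unfolding x_def using X V by (auto intro!: card_mono)
    have "p * real (card X) * real (card (Y \<inter> H)) = p * (u * x) * (x * u)" unfolding sq by simp
    also have "\<dots> \<le> p * (sqrt (real (card H)) * sqrt (real (card V))) * (x * y)"
      using p(1) uy xn sq by (intro mult_mono mult_left_mono mult_nonneg_nonneg) auto
    also have "\<dots> \<le> \<beta> / 2 * (x * y)" using Hsmall sq by (intro mult_right_mono) auto
    finally have 1: "p * real (card X) * real (card (Y \<inter> H)) \<le> \<beta> / 2 * (x * y)" .
    have "sqrt (real (card X) * real (card (Y \<inter> H))) = x * u" unfolding x_def u_def by (simp add: real_sqrt_mult)
    also have "\<dots> \<le> x * y" using uy sq by (intro mult_left_mono) auto
    finally have 2: "\<beta> * sqrt (real (card X) * real (card (Y \<inter> H))) \<le> \<beta> * (x * y)" using \<beta>(2) by (rule mult_left_mono)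
    have YH: "Y \<inter> H \<subseteq> V" using Y by auto
    have "weight (\<lambda>e. of_bool (e \<in> E)) X (Y \<inter> H)
        \<le> p * real (card X) * real (card (Y \<inter> H)) + \<beta> * sqrt (real (card X) * real (card (Y \<inter> H)))"
      using bijumbled_weight[OF jumbled V(1) X YH] by linarith
    also have "\<dots> \<le> 3/2 * \<beta> * (x * y)" using 1 2 by simp
    finally show ?thesis unfolding x_def y_def by (simp add: real_sqrt_mult)
  qed
  have wtq: "p * real (card X) * real (card Y) - 4 * \<beta> * sqrt (real (card X) * real (card Y)) \<le> weight q X Y \<and>
       weight q X Y \<le> p * real (card X) * real (card Y) + \<beta> * sqrt (real (card X) * real (card Y))"
    if X: "X \<subseteq> V" and Y: "Y \<subseteq> V" for X Y
  proof
    have fin: "finite X" "finite Y" using V X Y by (auto intro: finite_subset[of _ V])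
    have "weight q X Y \<le> weight (\<lambda>e. of_bool (e \<in> E)) X Y" by (intro weight_mono q01)
    then show "weight q X Y \<le> p * real (card X) * real (card Y) + \<beta> * sqrt (real (card X) * real (card Y))"
      using bijumbled_weight[OF jumbled V(1) X Y] by linarith
    have "weight (\<lambda>e. of_bool (e \<in> E)) X Y \<le> weight q X Y +
        (weight (\<lambda>e. of_bool (e \<in> E)) X (Y \<inter> H) + weight (\<lambda>e. of_bool (e \<in> E)) (X \<inter> H) Y)"
      by (rule weight_le_meeting[OF fin]) (use q01 in \<open>auto simp: q_def\<close>)
    moreover have "weight (\<lambda>e. of_bool (e \<in> E)) (X \<inter> H) Y \<le> 3/2 * \<beta> * sqrt (real (card X) * real (card Y))"
      using edges_at_H[OF Y X] by (subst weight_commute) (simp add: mult.commute)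
    ultimately show "p * real (card X) * real (card Y) - 4 * \<beta> * sqrt (real (card X) * real (card Y)) \<le> weight q X Y"
      using bijumbled_weight[OF jumbled V(1) X Y] edges_at_H[OF X Y] by (simp add: mult_ac)
  qed
  have q1: "0 \<le> q e \<and> q e \<le> 1" if "e \<in> E" for e using q01[of e] that by simp
  have q0: "q e = 0" if "e \<notin> E" for e using that by (simp add: q_def)
  show ?thesis by (rule that[OF q1 q0 low up wtq])
qed

section \<open>Rainbow members in bijumbled graphs\<close>

text \<open>
The survival probabilities \<open>\<rho> q\<close>, with the weights \<open>q\<close> of \<open>bounded_degree_weighting\<close>, turn the three parts into
the theorem with explicit constants.
\<close>

lemma rainbow_member_probability:
  fixes \<alpha> a K0 p \<beta> bstar d \<rho> :: real and V :: "'v set" and K S :: "'c set"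
  assumes const: "0 < \<alpha>" "0 < a" "0 < K0"
    and n: "2 \<le> card V" and p: "0 < p" "p \<le> 1" and \<beta>: "0 \<le> \<beta>" "\<beta> \<le> a * d"
    and G: "simple_graph V E" "bijumbled p \<beta> V E" and deg: "\<alpha> * d \<le> real (min_degree V E)"
    and h: "2 \<le> h" "configuration_family h V \<A>"
    and K: "finite K" "card K = Q" "S \<subseteq> K" "card S = l" "h \<le> l"
    and d: "d = p * real (card V)" and \<rho>: "\<rho> = (real l - real h + 1) / real Q"
    and bstar: "5 * \<rho> * \<beta> + 10000 * (K0 + 5) * (sqrt (\<rho> * (3 + a\<^sup>2 / \<alpha> + \<alpha>) * d) + sqrt (ln (real (card V)))) \<le> bstar"
    and supp: "\<And>J. simple_graph V J \<Longrightarrow> bijumbled (\<rho> * p) bstar V J \<Longrightarrow>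
                 \<alpha> / 2 / 2 * \<rho> * d \<le> real (min_degree V J) \<Longrightarrow> supports J \<A>"
  shows "1 - (2 * real (card V)) powr (- K0) - real (card V) * exp (- (\<alpha> / 2 * \<rho> * d / 8))
           \<le> measure_pmf.prob (uniform_colouring K E) {\<phi>. contains_rainbow E \<phi> S \<A>}"
proof -
  have V: "finite V" "E \<subseteq> nsets V 2" "V \<noteq> {}" using G n unfolding simple_graph_def by auto
  have E: "finite E" using V finite_imp_finite_nsets finite_subset by blast
  have d0: "0 < d" unfolding d using p n by simp
  have degv: "\<alpha> * d \<le> real (degree E v)" if "v \<in> V" for v
  proof -
    have "min_degree V E \<le> degree E v" unfolding min_degree_def using V that by simp
    then show ?thesis using deg by linarith
  qed
  obtain q where q: "\<And>e. e \<in> E \<Longrightarrow> 0 \<le> q e \<and> q e \<le> 1" "\<And>e. e \<notin> E \<Longrightarrow> q e = 0"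
    and q_low: "\<And>v. v \<in> V \<Longrightarrow> \<alpha> * d / 2 \<le> (\<Sum>e\<in>{e \<in> E. v \<in> e}. q e)"
    and q_up: "\<And>v. v \<in> V \<Longrightarrow> (\<Sum>e\<in>{e \<in> E. v \<in> e}. q e) \<le> (3 + a\<^sup>2 / \<alpha> + \<alpha>) * d"
    and q_weight: "\<And>X Y. X \<subseteq> V \<Longrightarrow> Y \<subseteq> V \<Longrightarrow>
       p * real (card X) * real (card Y) - 4 * \<beta> * sqrt (real (card X) * real (card Y)) \<le> weight q X Y \<and>
       weight q X Y \<le> p * real (card X) * real (card Y) + \<beta> * sqrt (real (card X) * real (card Y))"
    using bounded_degree_weighting[OF V(1,3,2) G(2) less_imp_le[OF p(1)] d d0 const(1) \<beta>(2,1) degv] by blast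
  have lQ: "l \<le> Q" using K card_mono by blast
  have \<rho>01: "0 < \<rho>" "\<rho> \<le> 1" unfolding \<rho> using lQ K(5) h(1) by (auto simp: field_simps)
  define c2 where "c2 = 3 + a\<^sup>2 / \<alpha> + \<alpha>"
  have c2: "1 \<le> c2" unfolding c2_def using const by simp
  define r where "r e = \<rho> * q e" for e
  define D where "D = \<rho> * c2 * d"
  define M where "M = random_edges E r"
  define J where "J w = {e \<in> E. w e}" for w
  have r01: "0 \<le> r e \<and> r e \<le> 1" "r e \<le> \<rho>" if "e \<in> E" for e
    using q(1)[OF that] \<rho>01 mult_le_one[of \<rho> "q e"] mult_left_mono[of "q e" 1 \<rho>] unfolding r_def by auto
  have r_sum: "(\<Sum>e\<in>F. r e) = \<rho> * (\<Sum>e\<in>F. q e)" for F unfolding r_def by (simp only: sum_distrib_left)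
  define b' where "b' = 5 * (\<rho> * \<beta>) + 5000 * (K0 + 5) * sqrt (D + ln (2 * real (card V)))"
  define bad1 where "bad1 = {w. \<not> bijumbled (\<rho> * p) b' V (J w)}"
  define bad2 where "bad2 = {w. \<exists>v\<in>V. (\<Sum>e\<in>{e \<in> E. v \<in> e}. of_bool (w e)) < (\<alpha> / 2 * \<rho> * d) / 2}"

  have p1: "measure_pmf.prob M bad1 \<le> (2 * real (card V)) powr (- K0)"
    unfolding M_def bad1_def J_def b'_def
  proof (rule random_subgraph_bijumbled[OF V(1,2) n r01(1)])
    show "r e = 0" if "e \<notin> E" for e using q(2)[OF that] by (simp add: r_def)
    show "(\<Sum>e\<in>{e \<in> E. v \<in> e}. r e) \<le> D" if "v \<in> V" for v
      using mult_left_mono[OF q_up[OF that], of \<rho>] \<rho>01 unfolding r_sum D_def c2_def by (simp add: mult.assoc)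
    show "\<rho> * p \<le> 1" using \<rho>01 p by (simp add: mult_le_one)
    have "\<rho> * (1 * d) \<le> \<rho> * (c2 * d)" using \<rho>01 c2 d0 by (intro mult_left_mono mult_right_mono) auto
    then show "\<rho> * p * real (card V) \<le> D" unfolding D_def d by (simp add: mult.assoc)
    fix X Y assume XY: "X \<subseteq> V" "Y \<subseteq> V"
    have "weight r X Y = \<rho> * weight q X Y" unfolding r_def by (rule weight_mult_left)
    then show "\<rho> * p * real (card X) * real (card Y) - 4 * (\<rho> * \<beta>) * sqrt (real (card X) * real (card Y)) \<le> weight r X Y \<and>
         weight r X Y \<le> \<rho> * p * real (card X) * real (card Y) + \<rho> * \<beta> * sqrt (real (card X) * real (card Y))"
      using mult_left_mono[OF conjunct1[OF q_weight[OF XY]], of \<rho>] mult_left_mono[OF conjunct2[OF q_weight[OF XY]], of \<rho>] \<rho>01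
      by (simp add: algebra_simps)
  qed (use \<rho>01 p \<beta> const in auto)

  have p2: "measure_pmf.prob M bad2 \<le> real (card V) * exp (- (\<alpha> / 2 * \<rho> * d / 8))"
  proof -
    have "measure_pmf.prob M bad2 \<le> (\<Sum>v\<in>V. exp (- (\<alpha> / 2 * \<rho> * d / 8)))"
      unfolding bad2_def
    proof (rule prob_ex_le_sum[OF V(1)])
      fix v assume v: "v \<in> V"
      have "\<alpha> / 2 * \<rho> * d \<le> (\<Sum>e\<in>{e \<in> E. v \<in> e}. r e)"
        using mult_left_mono[OF q_low[OF v], of \<rho>] \<rho>01 unfolding r_sum by (simp add: mult_ac)
      then show "measure_pmf.prob M {w. (\<Sum>e\<in>{e \<in> E. v \<in> e}. of_bool (w e)) < (\<alpha> / 2 * \<rho> * d) / 2}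
          \<le> exp (- (\<alpha> / 2 * \<rho> * d / 8))"
        unfolding M_def using const d0 \<rho>01 by (intro random_edges_lower_tail[OF E r01(1)]) auto
    qed
    then show ?thesis by simp
  qed

  have b'_le: "b' \<le> bstar"
  proof -
    have "ln (2 * real (card V)) = ln 2 + ln (real (card V))" using n by (simp add: ln_mult)
    moreover have "ln 2 \<le> ln (real (card V))" using n by simp
    moreover have "0 \<le> ln (real (card V))" using n by simp
    ultimately have L4: "ln (2 * real (card V)) \<le> 4 * ln (real (card V))" by linarith
    have L: "0 \<le> ln (2 * real (card V))" using n by simp
    have D: "0 \<le> D" unfolding D_def using \<rho>01 c2 d0 by simp
    have "sqrt (D + ln (2 * real (card V))) \<le> sqrt D + sqrt (ln (2 * real (card V)))"
      using D L by (intro sqrt_add_le_add_sqrt) auto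
    also have "\<dots> \<le> sqrt D + sqrt (4 * ln (real (card V)))"
      using L4 by (intro add_left_mono real_sqrt_le_mono)
    also have "sqrt (4 * ln (real (card V))) = 2 * sqrt (ln (real (card V)))" by (simp add: real_sqrt_mult)
    also have "sqrt D + 2 * sqrt (ln (real (card V))) \<le> 2 * sqrt D + 2 * sqrt (ln (real (card V)))"
      using D by (intro add_right_mono) simp
    finally have "sqrt (D + ln (2 * real (card V))) \<le> 2 * (sqrt D + sqrt (ln (real (card V))))"
      by (simp only: distrib_left)
    then have "5000 * (K0 + 5) * sqrt (D + ln (2 * real (card V)))
        \<le> 5000 * (K0 + 5) * (2 * (sqrt D + sqrt (ln (real (card V)))))"
      using const by (intro mult_left_mono) auto
    also have "\<dots> = 10000 * (K0 + 5) * (sqrt D + sqrt (ln (real (card V))))"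
      by (simp add: algebra_simps)
    finally show ?thesis using bstar unfolding b'_def D_def c2_def by (simp add: mult.assoc)
  qed

  have good: "supports (J w) \<A>" if w: "w \<notin> bad1" "w \<notin> bad2" for w
  proof (rule supp)
    show "simple_graph V (J w)" using V unfolding simple_graph_def J_def by auto
    show "bijumbled (\<rho> * p) bstar V (J w)" using w(1) b'_le unfolding bad1_def by (auto intro: bijumbled_mono)
    have "\<alpha> / 2 / 2 * \<rho> * d \<le> real (degree (J w) v)" if v: "v \<in> V" for v
    proof -
      have "(\<Sum>e\<in>{e \<in> E. v \<in> e}. of_bool (w e)) = real (card {e \<in> {e \<in> E. v \<in> e}. w e})"
        using E by (simp add: of_bool_def sum.If_cases Int_def)
      also have "{e \<in> {e \<in> E. v \<in> e}. w e} = {e \<in> J w. v \<in> e}" unfolding J_def by auto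
      finally show ?thesis using w(2) v unfolding bad2_def degree_def by force
    qed
    moreover have "min_degree V (J w) \<in> degree (J w) ` V"
      unfolding min_degree_def using V by (intro Min_in) auto
    ultimately show "\<alpha> / 2 / 2 * \<rho> * d \<le> real (min_degree V (J w))" by auto
  qed

  have "1 - (measure_pmf.prob M bad1 + measure_pmf.prob M bad2) \<le> 1 - measure_pmf.prob M (bad1 \<union> bad2)"
    using measure_Un_le[of bad1 M bad2] by simp
  also have "\<dots> = measure_pmf.prob M (UNIV - (bad1 \<union> bad2))"
    using measure_pmf.prob_compl[of "bad1 \<union> bad2" M] by simp
  also have "\<dots> \<le> measure_pmf.prob M {w. supports (J w) \<A>}"
    using good by (intro measure_pmf.finite_measure_mono) auto
  also have "\<dots> \<le> measure_pmf.prob (uniform_colouring K E) {\<phi>. contains_rainbow E \<phi> S \<A>}"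
    unfolding M_def J_def random_edges_def
  proof (rule prob_supports_le_prob_rainbow[OF E _ _ _ _ K])
    show "finite A \<and> card A = h" if "A \<in> \<A>" for A
      using h(2) that unfolding configuration_family_def nsets_def by auto
    show "r e \<le> (real l - real h + 1) / real Q" if "e \<in> E" for e using r01(2)[OF that] unfolding \<rho> .
  qed (use r01 in auto)
  finally show ?thesis using p1 p2 by linarith
qed

theorem theorem1p10:
  shows "\<exists>(c1 :: real \<Rightarrow> real) (c2 :: real \<Rightarrow> real \<Rightarrow> real) (dstar :: real \<Rightarrow> real) (C :: real \<Rightarrow> real).
    (\<forall>\<alpha> a K0. \<alpha> > 0 \<and> a > 0 \<and> K0 > 0 \<longrightarrow>
       c1 \<alpha> > 0 \<and> c2 \<alpha> a > 0 \<and> dstar \<alpha> > 0 \<and> C K0 > 0 \<and>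
       (\<forall>(V :: 'v set) (E :: 'v set set) (n :: nat) (p :: real) (\<beta> :: real)
          (\<A> :: 'v set set set) (h :: nat) (Q :: nat) (K :: 'c set) (S :: 'c set) (l :: nat)
          (bstar :: real).
          (let d = p * real n;
               \<rho> = (real l - real h + 1) / real Q;
               \<beta>hat = 5 * \<rho> * \<beta> + C K0 * (sqrt (\<rho> * c2 \<alpha> a * d) + sqrt (ln (real n)))
           in
             n \<ge> 2 \<and> 0 < p \<and> p \<le> 1 \<and> 0 \<le> \<beta> \<and> d \<ge> dstar \<alpha> \<and>
             simple_graph V E \<and> card V = n \<and> bijumbled p \<beta> V E \<and>
             real (min_degree V E) \<ge> \<alpha> * d \<and> \<beta> \<le> a * d \<and>
             2 \<le> h \<and> h \<le> Q \<and> configuration_family h V \<A> \<and>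
             finite K \<and> card K = Q \<and> S \<subseteq> K \<and> card S = l \<and> h \<le> l \<and>
             0 \<le> bstar \<and> \<beta>hat \<le> bstar \<and>
             (\<forall>J. simple_graph V J \<and> bijumbled (\<rho> * p) bstar V J \<and>
                   real (min_degree V J) \<ge> c1 \<alpha> / 2 * \<rho> * d \<longrightarrow> supports J \<A>)
             \<longrightarrow>
             measure_pmf.prob (uniform_colouring K E) {\<phi>. contains_rainbow E \<phi> S \<A>}
               \<ge> 1 - (2 * real n) powr (- K0) - real n * exp (- (c1 \<alpha> * \<rho> * d / 8)))))"
proof (rule exI[of _ "\<lambda>\<alpha>. \<alpha> / 2"], rule exI[of _ "\<lambda>\<alpha> a. 3 + a\<^sup>2 / \<alpha> + \<alpha>"], rule exI[of _ "\<lambda>_. 1"],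
    rule exI[of _ "\<lambda>K0. 10000 * (K0 + 5)"], intro allI impI conjI)
  fix \<alpha> a K0 :: real
  assume c: "\<alpha> > 0 \<and> a > 0 \<and> K0 > 0"
  then show "0 < \<alpha> / 2" "0 < 3 + a\<^sup>2 / \<alpha> + \<alpha>" "0 < (1 :: real)" "0 < 10000 * (K0 + 5)"
    by (auto intro!: add_pos_nonneg add_nonneg_pos)
  fix V :: "'v set" and E n p \<beta> \<A> h Q and K S :: "'c set" and l bstar
  show "let d = p * real n;
               \<rho> = (real l - real h + 1) / real Q;
               \<beta>hat = 5 * \<rho> * \<beta> + 10000 * (K0 + 5) * (sqrt (\<rho> * (3 + a\<^sup>2 / \<alpha> + \<alpha>) * d) + sqrt (ln (real n)))
           in
             n \<ge> 2 \<and> 0 < p \<and> p \<le> 1 \<and> 0 \<le> \<beta> \<and> d \<ge> 1 \<and>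
             simple_graph V E \<and> card V = n \<and> bijumbled p \<beta> V E \<and>
             real (min_degree V E) \<ge> \<alpha> * d \<and> \<beta> \<le> a * d \<and>
             2 \<le> h \<and> h \<le> Q \<and> configuration_family h V \<A> \<and>
             finite K \<and> card K = Q \<and> S \<subseteq> K \<and> card S = l \<and> h \<le> l \<and>
             0 \<le> bstar \<and> \<beta>hat \<le> bstar \<and>
             (\<forall>J. simple_graph V J \<and> bijumbled (\<rho> * p) bstar V J \<and>
                   real (min_degree V J) \<ge> \<alpha> / 2 / 2 * \<rho> * d \<longrightarrow> supports J \<A>)
             \<longrightarrow>
             measure_pmf.prob (uniform_colouring K E) {\<phi>. contains_rainbow E \<phi> S \<A>}
               \<ge> 1 - (2 * real n) powr (- K0) - real n * exp (- (\<alpha> / 2 * \<rho> * d / 8))"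
    unfolding Let_def
  proof (rule impI)
    assume H: "n \<ge> 2 \<and> 0 < p \<and> p \<le> 1 \<and> 0 \<le> \<beta> \<and> p * real n \<ge> 1 \<and>
             simple_graph V E \<and> card V = n \<and> bijumbled p \<beta> V E \<and>
             real (min_degree V E) \<ge> \<alpha> * (p * real n) \<and> \<beta> \<le> a * (p * real n) \<and>
             2 \<le> h \<and> h \<le> Q \<and> configuration_family h V \<A> \<and>
             finite K \<and> card K = Q \<and> S \<subseteq> K \<and> card S = l \<and> h \<le> l \<and>
             0 \<le> bstar \<and>
             5 * ((real l - real h + 1) / real Q) * \<beta> + 10000 * (K0 + 5) *
               (sqrt ((real l - real h + 1) / real Q * (3 + a\<^sup>2 / \<alpha> + \<alpha>) * (p * real n)) + sqrt (ln (real n))) \<le> bstar \<and>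
             (\<forall>J. simple_graph V J \<and> bijumbled ((real l - real h + 1) / real Q * p) bstar V J \<and>
                   real (min_degree V J) \<ge> \<alpha> / 2 / 2 * ((real l - real h + 1) / real Q) * (p * real n) \<longrightarrow> supports J \<A>)"
    then have n: "n = card V" by simp
    show "measure_pmf.prob (uniform_colouring K E) {\<phi>. contains_rainbow E \<phi> S \<A>}
        \<ge> 1 - (2 * real n) powr (- K0)
          - real n * exp (- (\<alpha> / 2 * ((real l - real h + 1) / real Q) * (p * real n) / 8))"
      unfolding n
    proof (rule rainbow_member_probability[where a = a and p = p and \<beta> = \<beta> and bstar = bstar
          and h = h and Q = Q and l = l and d = "p * real (card V)" and \<A> = \<A>])
      show "supports J \<A>" if "simple_graph V J" "bijumbled ((real l - real h + 1) / real Q * p) bstar V J"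
        "\<alpha> / 2 / 2 * ((real l - real h + 1) / real Q) * (p * real (card V)) \<le> real (min_degree V J)" for J
        using H that unfolding n by blast
    qed (rule refl | (insert c H[unfolded n], elim conjE, assumption))+
  qed
qed

end
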